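(* Let $\Gamma$ be any countable graph. There are $2^{\aleph_0}$ non-regular $\mathscr{D}$-classes of the endomorphism monoid of the countable universal graph $R$ such that the Schützenberger groups of $\mathscr{H}$-classes within them are isomorphic to $\operatorname{Aut}\Gamma$.
   Context: A graph is a pair $(V,E)$ with $E$ an irreflexive symmetric binary relation on $V$. The countable universal graph $R$ is the Fraïssé limit of the finite graphs (the unique countable existentially closed graph). $\operatorname{End} R$ is its endomorphism monoid, maps written on the right and $fg$ meaning first $f$ then $g$. Green's relations on a monoid $M$: $f\,\mathscr{L}\,g$ iff $Mf=Mg$; $f\,\mathscr{R}\,g$ iff $fM=gM$; $\mathscr{H}=\mathscr{L}\cap\mathscr{R}$; $\mathscr{D}=\mathscr{L}\circ\mathscr{R}$. An element $f$ is regular if $fgf=f$ for some $g\in M$; a $\mathscr{D}$-class is non-regular if its elements are not regular. For an $\mathscr{H}$-class $H$ of $M$, let $T_H=\{t\in M: Ht\subseteq H\}$ and for $t\in T_H$ let $\gamma_t:H\to H$, $h\mapsto ht$; the Schützenberger group of $H$ is the group $\{\gamma_t: t\in T_H\}$ of permutations of $H$. *)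

theory Defs
  imports "HOL-Algebra.Coset" "HOL-Library.Equipollence" "HOL-Library.Countable_Set"
begin

definition is_graph :: "'a set \<Rightarrow> ('a \<times> 'a) set \<Rightarrow> bool" where
  "is_graph V E \<longleftrightarrow> E \<subseteq> V \<times> V \<and> irrefl E \<and> sym E"

definition graph_embedding ::
  "'a set \<Rightarrow> ('a \<times> 'a) set \<Rightarrow> 'b set \<Rightarrow> ('b \<times> 'b) set \<Rightarrow> ('a \<Rightarrow> 'b) \<Rightarrow> bool" where
  "graph_embedding V E V' E' f \<longleftrightarrow>
     f \<in> V \<rightarrow> V' \<and> inj_on f V \<and> (\<forall>x\<in>V. \<forall>y\<in>V. (f x, f y) \<in> E' \<longleftrightarrow> (x, y) \<in> E)"

text \<open>Maps are written on the right, so the product of \<open>f\<close> and \<open>g\<close> is first \<open>f\<close>, then \<open>g\<close>.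
  Extensionality makes equality of monoid elements agree with equality as maps on \<open>V\<close>.\<close>

definition End_graph :: "'a set \<Rightarrow> ('a \<times> 'a) set \<Rightarrow> ('a \<Rightarrow> 'a) monoid" where
  "End_graph V E =
     \<lparr>carrier = {f \<in> V \<rightarrow>\<^sub>E V. \<forall>x\<in>V. \<forall>y\<in>V. (x, y) \<in> E \<longrightarrow> (f x, f y) \<in> E},
      monoid.mult = (\<lambda>f g. compose V g f),
      one = (\<lambda>x\<in>V. x)\<rparr>"

definition Aut_graph :: "'a set \<Rightarrow> ('a \<times> 'a) set \<Rightarrow> ('a \<Rightarrow> 'a) monoid" where
  "Aut_graph V E =
     \<lparr>carrier = {f \<in> extensional V. bij_betw f V V \<and>
        (\<forall>x\<in>V. \<forall>y\<in>V. (x, y) \<in> E \<longleftrightarrow> (f x, f y) \<in> E)},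
      monoid.mult = (\<lambda>f g. compose V g f),
      one = (\<lambda>x\<in>V. x)\<rparr>"

definition homogeneous_graph :: "'a set \<Rightarrow> ('a \<times> 'a) set \<Rightarrow> bool" where
  "homogeneous_graph V E \<longleftrightarrow>
     (\<forall>A f. finite A \<and> A \<subseteq> V \<and> graph_embedding A (E \<inter> A \<times> A) V E f
        \<longrightarrow> (\<exists>g\<in>carrier (Aut_graph V E). \<forall>x\<in>A. g x = f x))"

text \<open>The Fraisse limit of the finite graphs, determined up to isomorphism: the countable
  homogeneous graph whose age consists of all finite graphs. Every finite graph is isomorphic to
  one with natural numbers as vertices, so it is enough to embed those.\<close>

definition countable_universal_graph :: "'a set \<Rightarrow> ('a \<times> 'a) set \<Rightarrow> bool" where
  "countable_universal_graph V E \<longleftrightarrow>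
     is_graph V E \<and> countable V \<and> homogeneous_graph V E \<and>
     (\<forall>(W :: nat set) F. finite W \<and> is_graph W F \<longrightarrow> (\<exists>f. graph_embedding W F V E f))"

definition green_L :: "('a, 'b) monoid_scheme \<Rightarrow> ('a \<times> 'a) set" where
  "green_L M = {(f, g). f \<in> carrier M \<and> g \<in> carrier M \<and>
     carrier M #>\<^bsub>M\<^esub> f = carrier M #>\<^bsub>M\<^esub> g}"

definition green_R :: "('a, 'b) monoid_scheme \<Rightarrow> ('a \<times> 'a) set" where
  "green_R M = {(f, g). f \<in> carrier M \<and> g \<in> carrier M \<and>
     f <#\<^bsub>M\<^esub> carrier M = g <#\<^bsub>M\<^esub> carrier M}"

definition green_H :: "('a, 'b) monoid_scheme \<Rightarrow> ('a \<times> 'a) set" where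
  "green_H M = green_L M \<inter> green_R M"

definition green_D :: "('a, 'b) monoid_scheme \<Rightarrow> ('a \<times> 'a) set" where
  "green_D M = green_L M O green_R M"

definition regular_elem :: "('a, 'b) monoid_scheme \<Rightarrow> 'a \<Rightarrow> bool" where
  "regular_elem M f \<longleftrightarrow> f \<in> carrier M \<and> (\<exists>g\<in>carrier M. f \<otimes>\<^bsub>M\<^esub> g \<otimes>\<^bsub>M\<^esub> f = f)"

definition right_stabilizer :: "('a, 'b) monoid_scheme \<Rightarrow> 'a set \<Rightarrow> 'a set" where
  "right_stabilizer M H = {t \<in> carrier M. H #>\<^bsub>M\<^esub> t \<subseteq> H}"

definition Schutzenberger_group :: "('a, 'b) monoid_scheme \<Rightarrow> 'a set \<Rightarrow> ('a \<Rightarrow> 'a) monoid" where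
  "Schutzenberger_group M H =
     \<lparr>carrier = (\<lambda>t. \<lambda>h\<in>H. h \<otimes>\<^bsub>M\<^esub> t) ` right_stabilizer M H,
      monoid.mult = (\<lambda>p q. compose H q p),
      one = (\<lambda>h\<in>H. h)\<rparr>"

end

theory Submission
  imports Defs "HOL-Library.FSet"
begin

text \<open>
  For a graph \<open>X\<close>, the hereditarily finite sets over \<open>X\<close> as urelements form a graph extending \<open>X\<close>
  by (symmetrised) membership. It is countable and existentially closed, hence a copy of \<open>R\<close>, and
  every automorphism of \<open>X\<close> extends to it. Apply this first to the edgeless graph on the vertices
  of \<open>\<Gamma>\<close> together with countably many extra atoms, the clocks. This gives a copy of \<open>R\<close> to which
  more edges are added: those of \<open>\<Gamma>\<close>, edges from the clocks that make every clock and the rank of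
  every set definable, and edges between consecutive clocks coding a set \<open>S\<close> of naturals. The
  automorphisms preserving old and new edges are then exactly the lifts of \<open>Aut \<Gamma>\<close>, and \<open>S\<close> is an
  isomorphism invariant. Embedding the enlarged graph into its own graph of hereditarily finite
  sets yields an injective, non-regular endomorphism \<open>f\<^sub>S\<close> of \<open>R\<close>.

  An injective endomorphism \<open>f\<close> is right cancellable, so the Schuetzenberger group of its
  \<open>\<H>\<close>-class is the group of units \<open>u\<close> with \<open>uf \<R> f\<close>, i.e. of automorphisms of \<open>R\<close> that also
  preserve the edges pulled back along \<open>f\<close>; likewise \<open>f\<^sub>S \<D> f\<^sub>T\<close> forces the two enlarged structures
  to be isomorphic, so \<open>S = T\<close>.
\<close>

section \<open>Schuetzenberger groups in a monoid\<close>

context monoid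
begin

section \<open>Green's relations expressed by multipliers\<close>

lemma green_L_iff:
  "(f, g) \<in> green_L G \<longleftrightarrow> f \<in> carrier G \<and> g \<in> carrier G \<and>
     (\<exists>a\<in>carrier G. f = a \<otimes> g) \<and> (\<exists>b\<in>carrier G. g = b \<otimes> f)"
proof -
  have "carrier G #> x = carrier G #> y \<longleftrightarrow>
      (\<exists>a\<in>carrier G. x = a \<otimes> y) \<and> (\<exists>b\<in>carrier G. y = b \<otimes> x)"
    if x: "x \<in> carrier G" and y: "y \<in> carrier G" for x y
  proof
    assume eq: "carrier G #> x = carrier G #> y"
    have "x \<in> carrier G #> x" "y \<in> carrier G #> y"
      using x y l_one[symmetric] one_closed unfolding r_coset_def by blast+
    with eq show "(\<exists>a\<in>carrier G. x = a \<otimes> y) \<and> (\<exists>b\<in>carrier G. y = b \<otimes> x)"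
      unfolding r_coset_def by blast
  next
    have sub: "carrier G #> (a \<otimes> z) \<subseteq> carrier G #> z"
      if "a \<in> carrier G" "z \<in> carrier G" for a z
      using that unfolding r_coset_def by (auto simp: m_assoc[symmetric])
    assume "(\<exists>a\<in>carrier G. x = a \<otimes> y) \<and> (\<exists>b\<in>carrier G. y = b \<otimes> x)"
    then obtain a b where ab: "a \<in> carrier G" "b \<in> carrier G" "x = a \<otimes> y" "y = b \<otimes> x"
      by blast
    show "carrier G #> x = carrier G #> y"
      using sub[OF ab(1) y, folded ab(3)] sub[OF ab(2) x, folded ab(4)] by (rule subset_antisym)
  qed
  then show ?thesis
    unfolding green_L_def by blast
qed

lemma green_R_iff:
  "(f, g) \<in> green_R G \<longleftrightarrow> f \<in> carrier G \<and> g \<in> carrier G \<and>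
     (\<exists>a\<in>carrier G. f = g \<otimes> a) \<and> (\<exists>b\<in>carrier G. g = f \<otimes> b)"
proof -
  have "x <# carrier G = y <# carrier G \<longleftrightarrow>
      (\<exists>a\<in>carrier G. x = y \<otimes> a) \<and> (\<exists>b\<in>carrier G. y = x \<otimes> b)"
    if x: "x \<in> carrier G" and y: "y \<in> carrier G" for x y
  proof
    assume eq: "x <# carrier G = y <# carrier G"
    have "x \<in> x <# carrier G" "y \<in> y <# carrier G"
      using x y r_one[symmetric] one_closed unfolding l_coset_def by blast+
    with eq show "(\<exists>a\<in>carrier G. x = y \<otimes> a) \<and> (\<exists>b\<in>carrier G. y = x \<otimes> b)"
      unfolding l_coset_def by blast
  next
    have sub: "(z \<otimes> a) <# carrier G \<subseteq> z <# carrier G"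
      if "a \<in> carrier G" "z \<in> carrier G" for a z
      using that unfolding l_coset_def by (auto simp: m_assoc)
    assume "(\<exists>a\<in>carrier G. x = y \<otimes> a) \<and> (\<exists>b\<in>carrier G. y = x \<otimes> b)"
    then obtain a b where ab: "a \<in> carrier G" "b \<in> carrier G" "x = y \<otimes> a" "y = x \<otimes> b"
      by blast
    show "x <# carrier G = y <# carrier G"
      using sub[OF ab(1) y, folded ab(3)] sub[OF ab(2) x, folded ab(4)] by (rule subset_antisym)
  qed
  then show ?thesis
    unfolding green_R_def by blast
qed

lemma green_H_refl: "f \<in> carrier G \<Longrightarrow> (f, f) \<in> green_H G"
  by (simp add: green_H_def green_L_def green_R_def)

lemma green_D_refl: "f \<in> carrier G \<Longrightarrow> (f, f) \<in> green_D G"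
  by (force simp: green_D_def green_L_def green_R_def)

lemma green_H_classD:
  assumes "x \<in> green_H G `` {f}"
  obtains u u' w w' where "f \<in> carrier G" "x \<in> carrier G"
    "u \<in> carrier G" "u' \<in> carrier G" "w \<in> carrier G" "w' \<in> carrier G"
    "x = u \<otimes> f" "f = u' \<otimes> x" "x = f \<otimes> w" "f = x \<otimes> w'"
proof -
  have "(f, x) \<in> green_L G" "(f, x) \<in> green_R G"
    using assms by (simp_all add: green_H_def)
  then show thesis
    unfolding green_L_iff green_R_iff using that by blast
qed

lemma green_H_classI:
  assumes "f \<in> carrier G" "x \<in> carrier G"
    "u \<in> carrier G" "u' \<in> carrier G" "w \<in> carrier G" "w' \<in> carrier G"
    "x = u \<otimes> f" "f = u' \<otimes> x" "x = f \<otimes> w" "f = x \<otimes> w'"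
  shows "x \<in> green_H G `` {f}"
proof -
  have "(f, x) \<in> green_L G" "(f, x) \<in> green_R G"
    unfolding green_L_iff green_R_iff using assms by blast+
  then show ?thesis
    by (simp add: green_H_def)
qed

text \<open>The multipliers witnessing \<open>f \<D> h\<close>, in a form symmetric under exchanging \<open>f\<close> and \<open>h\<close>.\<close>

definition D_linked :: "'a \<Rightarrow> 'a \<Rightarrow> 'a \<Rightarrow> 'a \<Rightarrow> 'a \<Rightarrow> 'a \<Rightarrow> bool" where
  "D_linked f h a b c d \<longleftrightarrow>
     f \<in> carrier G \<and> h \<in> carrier G \<and> a \<in> carrier G \<and> b \<in> carrier G \<and>
     c \<in> carrier G \<and> d \<in> carrier G \<and> h = b \<otimes> f \<otimes> d \<and> f = a \<otimes> h \<otimes> c \<and>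
     a \<otimes> (b \<otimes> f) = f \<and> f \<otimes> d \<otimes> c = f \<and> b \<otimes> (a \<otimes> h) = h \<and> h \<otimes> c \<otimes> d = h"

lemma D_linked_sym: "D_linked f h a b c d \<Longrightarrow> D_linked h f b a d c"
  unfolding D_linked_def by blast

text \<open>The element \<open>g\<close> between \<open>f\<close> and \<open>h\<close> is eliminated
  through \<open>g = b f = h c\<close>. Left multipliers commute with right ones, so identities
  known at one end carry over to the other.\<close>

lemma green_D_linked:
  assumes "(f, h) \<in> green_D G"
  obtains a b c d where "D_linked f h a b c d"
proof -
  obtain g where "(f, g) \<in> green_L G" "(g, h) \<in> green_R G"
    using assms unfolding green_D_def by blast
  then obtain a b c d where *: "f \<in> carrier G" "g \<in> carrier G" "h \<in> carrier G"
      "a \<in> carrier G" "b \<in> carrier G" "c \<in> carrier G" "d \<in> carrier G"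
    and fa: "f = a \<otimes> g" and gb: "g = b \<otimes> f" and gc: "g = h \<otimes> c" and hd: "h = g \<otimes> d"
    unfolding green_L_iff green_R_iff by blast
  have "h \<otimes> c \<otimes> d = h" "a \<otimes> (b \<otimes> f) = f" "h = b \<otimes> f \<otimes> d"
    by (simp_all only: fa[symmetric] gb[symmetric] gc[symmetric] hd[symmetric])
  moreover have "f = a \<otimes> h \<otimes> c"
    using * by (simp add: m_assoc flip: fa gc)
  moreover have "f \<otimes> d \<otimes> c = f"
  proof -
    have "f \<otimes> d \<otimes> c = a \<otimes> (g \<otimes> d \<otimes> c)"
      unfolding fa using * by (simp add: m_assoc)
    then show ?thesis
      by (simp flip: fa gc hd)
  qed
  moreover have "b \<otimes> (a \<otimes> h) = h"
  proof -
    have "b \<otimes> (a \<otimes> h) = b \<otimes> (a \<otimes> g) \<otimes> d"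
      unfolding hd using * by (simp add: m_assoc)
    then show ?thesis
      by (simp flip: fa gb hd)
  qed
  ultimately have "D_linked f h a b c d"
    using * unfolding D_linked_def by blast
  then show thesis by (rule that)
qed

text \<open>If \<open>h k h = h\<close>, then \<open>d k b\<close> witnesses the regularity of
  \<open>f\<close>: writing the outer copies of \<open>f\<close> as \<open>a (b f)\<close> and
  \<open>f d c\<close> exposes \<open>h k h\<close> in the middle.\<close>

lemma regular_elem_D_linked:
  assumes "D_linked f h a b c d" "regular_elem G h"
  shows "regular_elem G f"
proof -
  have c: "f \<in> carrier G" "h \<in> carrier G" "a \<in> carrier G" "b \<in> carrier G" "c \<in> carrier G"
      "d \<in> carrier G"
    and e: "h = b \<otimes> f \<otimes> d" "f = a \<otimes> h \<otimes> c" "a \<otimes> (b \<otimes> f) = f" "f \<otimes> d \<otimes> c = f"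
    using assms(1) unfolding D_linked_def by blast+
  obtain k where k: "k \<in> carrier G" "h \<otimes> k \<otimes> h = h"
    using assms(2) by (auto simp: regular_elem_def)
  have "f \<otimes> (d \<otimes> k \<otimes> b) \<otimes> f = (a \<otimes> (b \<otimes> f)) \<otimes> (d \<otimes> k \<otimes> b) \<otimes> (f \<otimes> d \<otimes> c)"
    by (simp only: e(3,4))
  also have "\<dots> = a \<otimes> ((b \<otimes> f \<otimes> d) \<otimes> k \<otimes> (b \<otimes> f \<otimes> d)) \<otimes> c"
    using c k(1) by (simp add: m_assoc)
  also have "\<dots> = f"
    by (simp only: e(1)[symmetric] k(2) e(2)[symmetric])
  finally show ?thesis
    using c k(1) unfolding regular_elem_def by blast
qed

text \<open>Every \<open>x\<close> in the class is both \<open>f w\<close> and \<open>u f\<close>,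
  so the identities \<open>a (b f) = f\<close> and \<open>f d c = f\<close> extend from
  \<open>f\<close> to \<open>x\<close>. The multipliers of \<open>x\<close>, conjugated by
  \<open>b, a\<close> on the left and by \<open>c, d\<close> on the right, become those of
  \<open>b x d\<close>.\<close>

lemma D_linked_H_class:
  assumes "D_linked f h a b c d" "x \<in> green_H G `` {f}"
  shows "b \<otimes> x \<otimes> d \<in> green_H G `` {h}"
    and "a \<otimes> (b \<otimes> x \<otimes> d) \<otimes> c = x"
proof -
  have c: "f \<in> carrier G" "h \<in> carrier G" "a \<in> carrier G" "b \<in> carrier G" "c \<in> carrier G"
      "d \<in> carrier G"
    and e: "h = b \<otimes> f \<otimes> d" "f = a \<otimes> h \<otimes> c" "a \<otimes> (b \<otimes> f) = f" "f \<otimes> d \<otimes> c = f"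
    using assms(1) unfolding D_linked_def by blast+
  obtain u u' w w' where x: "x \<in> carrier G" "u \<in> carrier G" "u' \<in> carrier G"
      "w \<in> carrier G" "w' \<in> carrier G"
    and ux: "x = u \<otimes> f" and u'x: "f = u' \<otimes> x" and wx: "x = f \<otimes> w" and w'x: "f = x \<otimes> w'"
    using assms(2) by (rule green_H_classD) blast
  have abx: "a \<otimes> (b \<otimes> x) = x"
  proof -
    have "a \<otimes> (b \<otimes> x) = (a \<otimes> (b \<otimes> f)) \<otimes> w"
      unfolding wx using c x by (simp add: m_assoc)
    then show ?thesis
      by (simp add: e(3) flip: wx)
  qed
  have xdc: "x \<otimes> d \<otimes> c = x"
  proof -
    have "x \<otimes> d \<otimes> c = u \<otimes> (f \<otimes> d \<otimes> c)"
      unfolding ux using c x by (simp add: m_assoc)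
    then show ?thesis
      by (simp add: e(4) flip: ux)
  qed
  show "a \<otimes> (b \<otimes> x \<otimes> d) \<otimes> c = x"
    using c x abx xdc by (simp add: m_assoc)
  show "b \<otimes> x \<otimes> d \<in> green_H G `` {h}"
  proof (rule green_H_classI)
    show "b \<otimes> x \<otimes> d = (b \<otimes> u \<otimes> a) \<otimes> h"
    proof -
      have "(b \<otimes> u \<otimes> a) \<otimes> h = b \<otimes> (u \<otimes> (a \<otimes> (b \<otimes> f))) \<otimes> d"
        unfolding e(1) using c x by (simp add: m_assoc)
      then show ?thesis by (simp only: e(3) ux[symmetric])
    qed
    show "h = (b \<otimes> u' \<otimes> a) \<otimes> (b \<otimes> x \<otimes> d)"
    proof -
      have "(b \<otimes> u' \<otimes> a) \<otimes> (b \<otimes> x \<otimes> d) = b \<otimes> (u' \<otimes> (a \<otimes> (b \<otimes> x))) \<otimes> d"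
        using c x by (simp add: m_assoc)
      then show ?thesis by (simp only: abx u'x[symmetric] e(1)[symmetric])
    qed
    show "b \<otimes> x \<otimes> d = h \<otimes> (c \<otimes> w \<otimes> d)"
    proof -
      have "h \<otimes> (c \<otimes> w \<otimes> d) = b \<otimes> ((f \<otimes> d \<otimes> c) \<otimes> w) \<otimes> d"
        unfolding e(1) using c x by (simp add: m_assoc)
      then show ?thesis by (simp only: e(4) wx[symmetric])
    qed
    show "h = (b \<otimes> x \<otimes> d) \<otimes> (c \<otimes> w' \<otimes> d)"
    proof -
      have "(b \<otimes> x \<otimes> d) \<otimes> (c \<otimes> w' \<otimes> d) = b \<otimes> ((x \<otimes> d \<otimes> c) \<otimes> w') \<otimes> d"
        using c x by (simp add: m_assoc)
      then show ?thesis by (simp only: xdc w'x[symmetric] e(1)[symmetric])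
    qed
  qed (use c x in auto)
qed

lemma Schutzenberger_carrierE:
  assumes "p \<in> carrier (Schutzenberger_group G H)"
  obtains t where "t \<in> carrier G" "\<forall>x\<in>H. x \<otimes> t \<in> H" "p = (\<lambda>x\<in>H. x \<otimes> t)"
  using assms unfolding Schutzenberger_group_def right_stabilizer_def r_coset_def by auto

lemma Schutzenberger_carrierI:
  assumes "t \<in> carrier G" "\<And>x. x \<in> H \<Longrightarrow> x \<otimes> t \<in> H"
  shows "(\<lambda>x\<in>H. x \<otimes> t) \<in> carrier (Schutzenberger_group G H)"
  using assms unfolding Schutzenberger_group_def right_stabilizer_def r_coset_def by auto

lemma Schutzenberger_mult:
  "p \<otimes>\<^bsub>Schutzenberger_group G H\<^esub> q = compose H q p"
  by (simp add: Schutzenberger_group_def)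

text \<open>Green's lemma: conjugation by \<open>x \<mapsto> bxd\<close> carries \<open>\<gamma>\<^sub>t\<close> to \<open>\<gamma>\<close> of \<open>ctd\<close>.\<close>

lemma Schutzenberger_D_linked:
  assumes "D_linked f h a b c d"
  shows "Schutzenberger_group G (green_H G `` {f}) \<cong> Schutzenberger_group G (green_H G `` {h})"
proof -
  \<comment> \<open>All multipliers are arguments, so that exchanging \<open>f\<close> and
    \<open>h\<close> yields the inverse map from the same formula.\<close>
  define conj where "conj a b c d Y p = (\<lambda>y\<in>Y. b \<otimes> p (a \<otimes> y \<otimes> c) \<otimes> d)"
    for a b c d and Y :: "'a set" and p :: "'a \<Rightarrow> 'a"
  have conj_closed: "conj a b c d (green_H G `` {h}) p
      \<in> carrier (Schutzenberger_group G (green_H G `` {h}))"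
    if lk: "D_linked f h a b c d"
      and p: "p \<in> carrier (Schutzenberger_group G (green_H G `` {f}))" for f h a b c d p
  proof -
    obtain t where t: "t \<in> carrier G" "\<forall>x\<in>green_H G `` {f}. x \<otimes> t \<in> green_H G `` {f}"
      "p = (\<lambda>x\<in>green_H G `` {f}. x \<otimes> t)"
      using p by (rule Schutzenberger_carrierE)
    have c: "a \<in> carrier G" "b \<in> carrier G" "c \<in> carrier G" "d \<in> carrier G" "h \<in> carrier G"
      and bah: "b \<otimes> (a \<otimes> h) = h"
      using lk unfolding D_linked_def by blast+
    have "b \<otimes> p (a \<otimes> y \<otimes> c) \<otimes> d = y \<otimes> (c \<otimes> t \<otimes> d)" "b \<otimes> p (a \<otimes> y \<otimes> c) \<otimes> d \<in> green_H G `` {h}"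
      if y: "y \<in> green_H G `` {h}" for y
    proof -
      have x: "a \<otimes> y \<otimes> c \<in> green_H G `` {f}"
        by (rule D_linked_H_class(1)[OF D_linked_sym[OF lk] y])
      obtain w where w: "y \<in> carrier G" "w \<in> carrier G" "y = h \<otimes> w"
        using y by (rule green_H_classD) blast
      have "b \<otimes> (a \<otimes> y) = y"
      proof -
        have "b \<otimes> (a \<otimes> y) = (b \<otimes> (a \<otimes> h)) \<otimes> w"
          unfolding w(3) using c w by (simp add: m_assoc)
        then show ?thesis
          by (simp add: bah flip: w(3))
      qed
      moreover have "b \<otimes> (a \<otimes> y \<otimes> c \<otimes> t) \<otimes> d = b \<otimes> (a \<otimes> y) \<otimes> (c \<otimes> t \<otimes> d)"
        using c w(1) t(1) by (simp add: m_assoc)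
      ultimately show "b \<otimes> p (a \<otimes> y \<otimes> c) \<otimes> d = y \<otimes> (c \<otimes> t \<otimes> d)"
        using t(3) x by (simp del: Image_singleton_iff)
      have "p (a \<otimes> y \<otimes> c) \<in> green_H G `` {f}"
        using t(2,3) x by (simp del: Image_singleton_iff)
      then show "b \<otimes> p (a \<otimes> y \<otimes> c) \<otimes> d \<in> green_H G `` {h}"
        by (rule D_linked_H_class(1)[OF lk])
    qed
    note conj_apply = this
    then have "conj a b c d (green_H G `` {h}) p = (\<lambda>y\<in>green_H G `` {h}. y \<otimes> (c \<otimes> t \<otimes> d))"
      unfolding conj_def by (intro restrict_ext)
    also have "\<dots> \<in> carrier (Schutzenberger_group G (green_H G `` {h}))"
      using c t(1) conj_apply by (intro Schutzenberger_carrierI) (auto simp del: Image_singleton_iff)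
    finally show ?thesis .
  qed
  have Schutz_maps: "p x \<in> green_H G `` {f}"
    if "p \<in> carrier (Schutzenberger_group G (green_H G `` {f}))" "x \<in> green_H G `` {f}" for f p x
    using that(1) by (rule Schutzenberger_carrierE) (use that(2) in simp)
  have Schutz_ext: "p \<in> extensional (green_H G `` {f})"
    if "p \<in> carrier (Schutzenberger_group G (green_H G `` {f}))" for f p
    using that by (rule Schutzenberger_carrierE) simp
  have conj_conj: "conj b a d c (green_H G `` {f}) (conj a b c d (green_H G `` {h}) p) = p"
    if lk: "D_linked f h a b c d"
      and p: "p \<in> carrier (Schutzenberger_group G (green_H G `` {f}))" for f h a b c d p
  proof (rule extensionalityI)
    show "conj b a d c (green_H G `` {f}) (conj a b c d (green_H G `` {h}) p)
      \<in> extensional (green_H G `` {f})" by (simp add: conj_def)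
    show "p \<in> extensional (green_H G `` {f})" using p by (rule Schutz_ext)
    fix x assume x: "x \<in> green_H G `` {f}"
    show "conj b a d c (green_H G `` {f}) (conj a b c d (green_H G `` {h}) p) x = p x"
      unfolding conj_def using x D_linked_H_class[OF lk x] D_linked_H_class(2)[OF lk Schutz_maps[OF p x]]
      by (simp del: Image_singleton_iff)
  qed
  let ?h = "conj a b c d (green_H G `` {h})"
  have "?h \<in> hom (Schutzenberger_group G (green_H G `` {f})) (Schutzenberger_group G (green_H G `` {h}))"
  proof (rule homI)
    fix p q
    assume p: "p \<in> carrier (Schutzenberger_group G (green_H G `` {f}))"
      and q: "q \<in> carrier (Schutzenberger_group G (green_H G `` {f}))"
    show "?h p \<in> carrier (Schutzenberger_group G (green_H G `` {h}))"
      using assms p by (rule conj_closed)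
    show "?h (p \<otimes>\<^bsub>Schutzenberger_group G (green_H G `` {f})\<^esub> q)
        = ?h p \<otimes>\<^bsub>Schutzenberger_group G (green_H G `` {h})\<^esub> ?h q"
      unfolding Schutzenberger_mult
    proof (rule extensionalityI)
      show "?h (compose (green_H G `` {f}) q p) \<in> extensional (green_H G `` {h})"
        by (simp add: conj_def)
      show "compose (green_H G `` {h}) (?h q) (?h p) \<in> extensional (green_H G `` {h})"
        by (simp add: compose_def)
      fix y assume y: "y \<in> green_H G `` {h}"
      have x: "a \<otimes> y \<otimes> c \<in> green_H G `` {f}"
        by (rule D_linked_H_class(1)[OF D_linked_sym[OF assms] y])
      show "?h (compose (green_H G `` {f}) q p) y = compose (green_H G `` {h}) (?h q) (?h p) y"
        using x y D_linked_H_class[OF assms Schutz_maps[OF p x]]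
        by (simp add: conj_def compose_def del: Image_singleton_iff)
    qed
  qed
  moreover have "bij_betw ?h (carrier (Schutzenberger_group G (green_H G `` {f})))
      (carrier (Schutzenberger_group G (green_H G `` {h})))"
    by (rule bij_betw_byWitness[where f' = "conj b a d c (green_H G `` {f})"])
      (use assms D_linked_sym[OF assms] conj_closed conj_conj in blast)+
  ultimately show ?thesis
    unfolding is_iso_def iso_def by blast
qed

section \<open>Right cancellable elements\<close>

definition right_cancellable :: "'a \<Rightarrow> bool" where
  "right_cancellable f \<longleftrightarrow> f \<in> carrier G \<and>
     (\<forall>x\<in>carrier G. \<forall>y\<in>carrier G. x \<otimes> f = y \<otimes> f \<longrightarrow> x = y)"

lemma right_cancellable_unit:
  assumes "right_cancellable f" "x \<in> carrier G" "x \<otimes> f = f"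
  shows "x = \<one>"
  using assms unfolding right_cancellable_def by simp

text \<open>Cancelling \<open>f\<close> in \<open>a b f = f\<close> and \<open>h\<close> in
  \<open>b a h = h\<close> makes \<open>a\<close> and \<open>b\<close> mutually inverse, so the left
  half of the D-relation is realised by a unit.\<close>

lemma right_cancellable_green_D:
  assumes "(f, h) \<in> green_D G" "right_cancellable f" "right_cancellable h"
  obtains b where "b \<in> Units G" "(b \<otimes> f, h) \<in> green_R G"
proof -
  obtain a b c d where "D_linked f h a b c d"
    using assms(1) by (rule green_D_linked)
  then have c: "f \<in> carrier G" "h \<in> carrier G" "a \<in> carrier G" "b \<in> carrier G" "c \<in> carrier G"
      "d \<in> carrier G"
    and e: "h = b \<otimes> f \<otimes> d" "f = a \<otimes> h \<otimes> c" "a \<otimes> (b \<otimes> f) = f" "b \<otimes> (a \<otimes> h) = h"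
    unfolding D_linked_def by blast+
  have "a \<otimes> b = \<one>" "b \<otimes> a = \<one>"
    using right_cancellable_unit[OF assms(2), of "a \<otimes> b"] right_cancellable_unit[OF assms(3), of "b \<otimes> a"]
      c e(3,4) by (simp_all add: m_assoc)
  then have "b \<in> Units G"
    using c by (auto simp: Units_def)
  moreover have "b \<otimes> f = h \<otimes> c"
  proof -
    have "b \<otimes> f = (b \<otimes> (a \<otimes> h)) \<otimes> c"
      unfolding e(2) using c by (simp add: m_assoc)
    then show ?thesis
      by (simp add: e(4))
  qed
  then have "(b \<otimes> f, h) \<in> green_R G"
    unfolding green_R_iff using c e(1) by blast
  ultimately show thesis by (rule that)
qed

text \<open>For right cancellable \<open>f\<close> the \<open>\<H>\<close>-class of \<open>f\<close> consists of the elements \<open>uf\<close> with \<open>u\<close>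
  a unit such that \<open>uf \<R> f\<close>, and \<open>\<gamma>\<^sub>t\<close> corresponds to the unique such \<open>u\<close> with \<open>ft = uf\<close>.\<close>

lemma Schutzenberger_right_cancellable:
  assumes f: "right_cancellable f"
    and hom: "\<theta> \<in> hom A G" and inj: "inj_on \<theta> (carrier A)"
    and img: "\<theta> ` carrier A = {u \<in> Units G. (u \<otimes> f, f) \<in> green_R G}"
    and A_closed: "\<And>x y. x \<in> carrier A \<Longrightarrow> y \<in> carrier A \<Longrightarrow> x \<otimes>\<^bsub>A\<^esub> y \<in> carrier A"
  shows "A \<cong> Schutzenberger_group G (green_H G `` {f})"
proof -
  let ?H = "green_H G `` {f}"
  have fc: "f \<in> carrier G"
    and canc: "\<And>x y. x \<in> carrier G \<Longrightarrow> y \<in> carrier G \<Longrightarrow> x \<otimes> f = y \<otimes> f \<Longrightarrow> x = y"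
    using f by (auto simp: right_cancellable_def)
  have fH: "f \<in> ?H"
    using fc green_H_refl by simp
  have "\<exists>t\<in>carrier G. f \<otimes> t = \<theta> x \<otimes> f" if "x \<in> carrier A" for x
  proof -
    have "(\<theta> x \<otimes> f, f) \<in> green_R G" using img that by blast
    then show ?thesis unfolding green_R_iff by metis
  qed
  \<comment> \<open>\<open>t x\<close> does on the right of \<open>f\<close> what the unit
    \<open>\<theta> x\<close> does on the left. It need not be unique, but its action on the class
    is.\<close>
  then obtain t where t: "\<And>x. x \<in> carrier A \<Longrightarrow> t x \<in> carrier G"
      "\<And>x. x \<in> carrier A \<Longrightarrow> f \<otimes> t x = \<theta> x \<otimes> f"
    by metis
  have \<theta>U: "\<theta> x \<in> Units G" "\<theta> x \<in> carrier G" if "x \<in> carrier A" for x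
    using img that by auto
  have stab: "y \<otimes> t x \<in> ?H" if x: "x \<in> carrier A" and y: "y \<in> ?H" for x y
  proof -
    obtain u u' w w' where c: "y \<in> carrier G" "u \<in> carrier G" "u' \<in> carrier G"
        "w \<in> carrier G" "w' \<in> carrier G"
      and uy: "y = u \<otimes> f" and u'y: "f = u' \<otimes> y" and wy: "y = f \<otimes> w" and w'y: "f = y \<otimes> w'"
      using y by (rule green_H_classD) blast
    have "(\<theta> x \<otimes> f, f) \<in> green_R G" using img x by blast
    then obtain s where s: "s \<in> carrier G" "f = f \<otimes> t x \<otimes> s"
      unfolding green_R_iff using t(2)[OF x] by auto
    note xs = t(1)[OF x] \<theta>U[OF x]
    show ?thesis
    proof (rule green_H_classI)
      show "y \<otimes> t x = (u \<otimes> \<theta> x) \<otimes> f"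
        using c xs fc uy t(2)[OF x] by (simp add: m_assoc)
      show "y \<otimes> t x = f \<otimes> (w \<otimes> t x)"
        using c xs fc wy by (simp add: m_assoc)
      have "(inv \<theta> x \<otimes> u') \<otimes> (y \<otimes> t x) = inv \<theta> x \<otimes> ((u' \<otimes> y) \<otimes> t x)"
        using c xs by (simp add: m_assoc)
      also have "\<dots> = inv \<theta> x \<otimes> (\<theta> x \<otimes> f)"
        by (simp only: u'y[symmetric] t(2)[OF x])
      also have "\<dots> = f"
        using xs fc by (simp add: m_assoc[symmetric])
      finally show "f = (inv \<theta> x \<otimes> u') \<otimes> (y \<otimes> t x)" by simp
      have "(y \<otimes> t x) \<otimes> (s \<otimes> w') = u \<otimes> (f \<otimes> t x \<otimes> s) \<otimes> w'"
        using c xs fc s(1) uy by (simp add: m_assoc)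
      then show "f = (y \<otimes> t x) \<otimes> (s \<otimes> w')"
        by (simp only: s(2)[symmetric] uy[symmetric] w'y[symmetric])
    qed (use c xs fc s in auto)
  qed
  \<comment> \<open>Each element of the class is a left multiple of \<open>f\<close>, so the product
    of \<open>f\<close> with a right multiplier determines the action on the whole class.\<close>
  have act: "y \<otimes> r = y \<otimes> r'" if "y \<in> ?H" "f \<otimes> r = f \<otimes> r'" "r \<in> carrier G" "r' \<in> carrier G"
    for y r r'
    using that(1)
  proof (rule green_H_classD)
    fix u assume "u \<in> carrier G" "y = u \<otimes> f"
    then show ?thesis using that fc by (simp add: m_assoc)
  qed
  have inHc: "y \<in> carrier G" if "y \<in> ?H" for y
    using that by (rule green_H_classD) blast
  let ?\<Theta> = "\<lambda>x. \<lambda>y\<in>?H. y \<otimes> t x"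
  have "?\<Theta> \<in> hom A (Schutzenberger_group G ?H)"
  proof (rule homI)
    fix x assume x: "x \<in> carrier A"
    show "?\<Theta> x \<in> carrier (Schutzenberger_group G ?H)"
      using t(1)[OF x] stab[OF x] by (rule Schutzenberger_carrierI)
    fix x' assume x': "x' \<in> carrier A"
    note cs = t(1)[OF x] t(1)[OF x'] \<theta>U(2)[OF x] \<theta>U(2)[OF x'] fc
    have "f \<otimes> t (x \<otimes>\<^bsub>A\<^esub> x') = \<theta> x \<otimes> \<theta> x' \<otimes> f"
      using A_closed x x' hom t(2) by (metis hom_mult)
    also have "\<dots> = \<theta> x \<otimes> f \<otimes> t x'"
      using cs t(2)[OF x'] by (simp add: m_assoc)
    also have "\<dots> = f \<otimes> (t x \<otimes> t x')"
      using cs t(2)[OF x] by (simp add: m_assoc[symmetric])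
    finally have *: "f \<otimes> t (x \<otimes>\<^bsub>A\<^esub> x') = f \<otimes> (t x \<otimes> t x')" .
    have "y \<otimes> t (x \<otimes>\<^bsub>A\<^esub> x') = y \<otimes> t x \<otimes> t x'" if y: "y \<in> ?H" for y
      using act[OF y *] t(1) A_closed x x' cs inHc[OF y] by (simp add: m_assoc)
    then show "?\<Theta> (x \<otimes>\<^bsub>A\<^esub> x') = ?\<Theta> x \<otimes>\<^bsub>Schutzenberger_group G ?H\<^esub> ?\<Theta> x'"
      unfolding Schutzenberger_mult compose_def using stab[OF x]
      by (intro restrict_ext) (simp del: Image_singleton_iff)
  qed
  moreover have "inj_on ?\<Theta> (carrier A)"
  proof (rule inj_onI)
    fix x x' assume x: "x \<in> carrier A" and x': "x' \<in> carrier A" and "?\<Theta> x = ?\<Theta> x'"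
    then have "f \<otimes> t x = f \<otimes> t x'"
      using fH by (metis restrict_apply')
    then have "\<theta> x = \<theta> x'"
      using canc \<theta>U(2) t(2) x x' by simp
    then show "x = x'" using inj x x' by (simp add: inj_on_eq_iff)
  qed
  moreover have "carrier (Schutzenberger_group G ?H) \<subseteq> ?\<Theta> ` carrier A"
  proof
    fix p assume "p \<in> carrier (Schutzenberger_group G ?H)"
    then obtain r where r: "r \<in> carrier G" "\<forall>x\<in>?H. x \<otimes> r \<in> ?H" "p = (\<lambda>x\<in>?H. x \<otimes> r)"
      by (rule Schutzenberger_carrierE)
    have "f \<otimes> r \<in> ?H" using r(2) fH by blast
    then obtain u u' w w' where c: "u \<in> carrier G" "u' \<in> carrier G" "w' \<in> carrier G"
      and u: "f \<otimes> r = u \<otimes> f" and u': "f = u' \<otimes> (f \<otimes> r)" and w': "f = f \<otimes> r \<otimes> w'"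
      by (rule green_H_classD) blast
    have "u' \<otimes> u \<otimes> f = u' \<otimes> (f \<otimes> r)"
      unfolding u using c fc by (simp add: m_assoc)
    then have "u' \<otimes> u = \<one>"
      using c by (intro right_cancellable_unit[OF f]) (simp_all only: u'[symmetric] m_closed)
    \<comment> \<open>The action of \<open>u'\<close> is known on \<open>f r\<close> only, so
      \<open>f\<close> is first written as \<open>f r w'\<close>.\<close>
    moreover have "u \<otimes> u' \<otimes> f = f"
    proof -
      have "u \<otimes> u' \<otimes> f = u \<otimes> u' \<otimes> (f \<otimes> r \<otimes> w')" by (simp only: w'[symmetric])
      also have "\<dots> = u \<otimes> (u' \<otimes> (f \<otimes> r)) \<otimes> w'" using c fc r(1) by (simp add: m_assoc)
      also have "\<dots> = f" by (simp only: u'[symmetric] u[symmetric] w'[symmetric])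
      finally show ?thesis .
    qed
    then have "u \<otimes> u' = \<one>"
      using c by (intro right_cancellable_unit[OF f]) auto
    ultimately have "u \<in> Units G"
      using c by (auto simp: Units_def)
    moreover have "(u \<otimes> f, f) \<in> green_R G"
      unfolding green_R_iff u[symmetric] using c(3) fc r(1) w' m_closed by blast
    ultimately obtain x where x: "x \<in> carrier A" "u = \<theta> x"
      using img by blast
    have "f \<otimes> r = f \<otimes> t x" using u x t(2) by simp
    then have "p = ?\<Theta> x"
      unfolding r(3) using act r(1) t(1)[OF x(1)] by (intro restrict_ext) blast
    then show "p \<in> ?\<Theta> ` carrier A" using x(1) by blast
  qed
  ultimately have "?\<Theta> \<in> iso A (Schutzenberger_group G ?H)"
    unfolding iso_def bij_betw_def hom_def by blast
  then show ?thesis unfolding is_iso_def by blast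
qed

end

section \<open>Existentially closed graphs\<close>

text \<open>The one-point extension property of the Rado graph.\<close>

definition ec_graph :: "'a set \<Rightarrow> ('a \<times> 'a) set \<Rightarrow> bool" where
  "ec_graph V E \<longleftrightarrow> is_graph V E \<and>
     (\<forall>A B. finite A \<and> finite B \<and> A \<subseteq> V \<and> B \<subseteq> V \<and> A \<inter> B = {} \<longrightarrow>
        (\<exists>z\<in>V. z \<notin> A \<union> B \<and> (\<forall>a\<in>A. (z, a) \<in> E) \<and> (\<forall>b\<in>B. (z, b) \<notin> E)))"

definition graph_iso :: "'a set \<Rightarrow> ('a \<times> 'a) set \<Rightarrow> 'b set \<Rightarrow> ('b \<times> 'b) set \<Rightarrow> ('a \<Rightarrow> 'b) \<Rightarrow> bool" where
  "graph_iso V E W F \<phi> \<longleftrightarrow> bij_betw \<phi> V W \<and>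
     (\<forall>x\<in>V. \<forall>y\<in>V. (\<phi> x, \<phi> y) \<in> F \<longleftrightarrow> (x, y) \<in> E)"

lemma ec_graph_nonempty: "ec_graph V E \<Longrightarrow> V \<noteq> {}"
  unfolding ec_graph_def by (auto dest!: conjunct2 spec[of _ "{}"])

text \<open>Universality realises the pattern of a new vertex over \<open>A \<union> B\<close>
  somewhere in the graph, and homogeneity moves that copy back onto \<open>A \<union> B\<close>
  itself.\<close>

lemma universal_graph_ec:
  assumes "countable_universal_graph V E"
  shows "ec_graph V E"
proof -
  have g: "is_graph V E" and hom: "homogeneous_graph V E"
    and univ: "\<And>(W :: nat set) F. finite W \<Longrightarrow> is_graph W F \<Longrightarrow> \<exists>f. graph_embedding W F V E f"
    using assms by (auto simp: countable_universal_graph_def)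
  have "\<exists>z\<in>V. z \<notin> A \<union> B \<and> (\<forall>a\<in>A. (z, a) \<in> E) \<and> (\<forall>b\<in>B. (z, b) \<notin> E)"
    if fin: "finite A" "finite B" and sub: "A \<subseteq> V" "B \<subseteq> V" and disj: "A \<inter> B = {}" for A B
  proof -
    let ?C = "A \<union> B"
    obtain e :: "'a \<Rightarrow> nat" where e: "inj_on e ?C" "finite (e ` ?C)"
      using fin finite_imp_inj_to_nat_seg[of ?C] by auto
    obtain n where n: "n \<notin> e ` ?C"
      using e(2) ex_new_if_finite infinite_UNIV_nat by blast
    \<comment> \<open>The pattern to be realised: a copy of the graph on \<open>?C\<close>, with a
      new vertex \<open>n\<close> joined exactly to the copy of \<open>A\<close>. The vertices are
      naturals because universality is formulated for those.\<close>
    define F where "F = {(e x, e y) | x y. x \<in> ?C \<and> y \<in> ?C \<and> (x, y) \<in> E} \<union>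
        {(n, e a) | a. a \<in> A} \<union> {(e a, n) | a. a \<in> A}"
    have "is_graph (insert n (e ` ?C)) F"
    proof -
      have "irrefl F"
      proof (rule irreflI)
        fix m
        have "x \<noteq> y" if "(x, y) \<in> E" for x y
          using g that by (auto simp: is_graph_def irrefl_def)
        then show "(m, m) \<notin> F"
          using e(1) n by (fastforce simp: F_def inj_on_eq_iff)
      qed
      moreover have "sym F"
      proof (rule symI)
        fix a b assume "(a, b) \<in> F"
        moreover have "(y, x) \<in> E" if "(x, y) \<in> E" for x y
          using g that by (auto simp: is_graph_def dest: symD)
        ultimately show "(b, a) \<in> F"
          unfolding F_def by blast
      qed
      ultimately show ?thesis
        unfolding is_graph_def F_def by auto
    qed
    then obtain f where f: "graph_embedding (insert n (e ` ?C)) F V E f"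
      using univ e(2) by (meson finite.insertI)
    define D where "D = (\<lambda>x. f (e x)) ` ?C"
    have finj: "inj_on (\<lambda>x. f (e x)) ?C"
      using f e(1) by (auto simp: graph_embedding_def inj_on_def)
    \<comment> \<open>\<open>k\<close> takes the embedded copy \<open>D\<close> back to
      \<open>?C\<close>; an automorphism \<open>q\<close> extending it will carry \<open>f n\<close>
      to the vertex sought.\<close>
    define k where "k = the_inv_into ?C (\<lambda>x. f (e x))"
    have k: "k (f (e x)) = x" if "x \<in> ?C" for x
      unfolding k_def using finj that by (rule the_inv_into_f_f)
    have fe: "(f (e x), f (e y)) \<in> E \<longleftrightarrow> (x, y) \<in> E" if "x \<in> ?C" "y \<in> ?C" for x y
    proof -
      have "(f (e x), f (e y)) \<in> E \<longleftrightarrow> (e x, e y) \<in> F"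
        using f that by (auto simp: graph_embedding_def)
      also have "\<dots> \<longleftrightarrow> (x, y) \<in> E"
      proof
        assume "(e x, e y) \<in> F"
        moreover have "e x \<noteq> n" "e y \<noteq> n" using n that by auto
        ultimately obtain x' y' where "e x = e x'" "e y = e y'" "x' \<in> ?C" "y' \<in> ?C" "(x', y') \<in> E"
          unfolding F_def by auto
        then show "(x, y) \<in> E"
          using e(1) that by (metis inj_on_eq_iff)
      qed (use that in \<open>auto simp: F_def\<close>)
      finally show ?thesis .
    qed
    have DV: "D \<subseteq> V"
      using f by (auto simp: graph_embedding_def D_def)
    have emb: "graph_embedding D (E \<inter> D \<times> D) V E k"
      unfolding graph_embedding_def
    proof (intro conjI ballI)
      show "k \<in> D \<rightarrow> V" using k sub by (auto simp: D_def)
      show "inj_on k D" using k by (auto simp: D_def inj_on_def)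
      fix x y assume "x \<in> D" "y \<in> D"
      then show "(k x, k y) \<in> E \<longleftrightarrow> (x, y) \<in> E \<inter> D \<times> D"
        using k fe by (auto simp: D_def)
    qed
    have "finite D" using fin by (simp add: D_def)
    then have "\<exists>g\<in>carrier (Aut_graph V E). \<forall>x\<in>D. g x = k x"
      using hom DV emb unfolding homogeneous_graph_def by blast
    then obtain q where q: "bij_betw q V V" "\<And>x y. x \<in> V \<Longrightarrow> y \<in> V \<Longrightarrow> (x, y) \<in> E \<longleftrightarrow> (q x, q y) \<in> E"
      "\<And>x. x \<in> D \<Longrightarrow> q x = k x"
      unfolding Aut_graph_def by auto
    have qe: "q (f (e x)) = x" if "x \<in> ?C" for x
      using q(3)[of "f (e x)"] k[OF that] that by (auto simp: D_def)
    have fV: "f n \<in> V" "\<And>x. x \<in> ?C \<Longrightarrow> f (e x) \<in> V"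
      using f by (auto simp: graph_embedding_def)
    have adj: "(q (f n), x) \<in> E \<longleftrightarrow> (n, e x) \<in> F" if x: "x \<in> ?C" for x
    proof -
      have "(q (f n), x) \<in> E \<longleftrightarrow> (q (f n), q (f (e x))) \<in> E"
        using qe[OF x] by simp
      also have "\<dots> \<longleftrightarrow> (f n, f (e x)) \<in> E"
        using q(2)[of "f n" "f (e x)"] fV x by simp
      also have "\<dots> \<longleftrightarrow> (n, e x) \<in> F"
        using f x by (auto simp: graph_embedding_def)
      finally show ?thesis .
    qed
    have nF: "(n, e x) \<in> F \<longleftrightarrow> x \<in> A" if x: "x \<in> ?C" for x
    proof
      assume "(n, e x) \<in> F"
      then obtain a where "a \<in> A" "e x = e a"
        using n x unfolding F_def by auto
      then show "x \<in> A"
        using e(1) x by (metis Un_iff inj_on_eq_iff)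
    qed (auto simp: F_def)
    show ?thesis
    proof (intro bexI conjI ballI)
      show "q (f n) \<in> V" using q(1) fV by (auto simp: bij_betw_def)
      show "q (f n) \<notin> ?C"
      proof
        assume C: "q (f n) \<in> ?C"
        then have "q (f (e (q (f n)))) = q (f n)" by (rule qe)
        then have eq: "f (e (q (f n))) = f n"
          using q(1) fV C by (metis bij_betw_inv_into_left)
        have "inj_on f (insert n (e ` ?C))"
          using f by (simp add: graph_embedding_def)
        from inj_onD[OF this eq] have "e (q (f n)) = n"
          using C by blast
        then show False using n C by (metis imageI)
      qed
      show "(q (f n), a) \<in> E" if "a \<in> A" for a
        using adj nF that by blast
      show "(q (f n), b) \<notin> E" if "b \<in> B" for b
        using adj nF that disj by blast
    qed
  qed
  then show ?thesis
    using g by (simp add: ec_graph_def)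
qed

section \<open>Back and forth\<close>

definition partial_graph_iso ::
  "'a set \<Rightarrow> ('a \<times> 'a) set \<Rightarrow> 'b set \<Rightarrow> ('b \<times> 'b) set \<Rightarrow> ('a \<times> 'b) set \<Rightarrow> bool" where
  "partial_graph_iso V E W F p \<longleftrightarrow> p \<subseteq> V \<times> W \<and>
     (\<forall>x y x' y'. (x, y) \<in> p \<longrightarrow> (x', y') \<in> p \<longrightarrow>
        (x = x' \<longleftrightarrow> y = y') \<and> ((x, x') \<in> E \<longleftrightarrow> (y, y') \<in> F))"

text \<open>Partial isomorphisms are relations rather than functions, so that the back step is the
  forth step applied to the converse.\<close>

lemma partial_graph_iso_converse:
  "partial_graph_iso V E W F p \<Longrightarrow> partial_graph_iso W F V E (p\<inverse>)"
proof -
  assume p: "partial_graph_iso V E W F p"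
  then have "p\<inverse> \<subseteq> W \<times> V"
    by (auto simp: partial_graph_iso_def)
  then show ?thesis
    using p unfolding partial_graph_iso_def converse_iff by simp
qed

text \<open>The images of the neighbours and of the non-neighbours of \<open>x\<close> are disjoint
  finite sets, so existential closure of the target supplies an image for \<open>x\<close>.\<close>

lemma partial_graph_iso_extend:
  assumes V: "is_graph V E" and W: "ec_graph W F" and p: "partial_graph_iso V E W F p" "finite p"
    and x: "x \<in> V"
  shows "\<exists>y. partial_graph_iso V E W F (insert (x, y) p)"
proof (cases "x \<in> Domain p")
  case True
  then obtain y where "(x, y) \<in> p" by blast
  then show ?thesis using p(1) by (metis insert_absorb)
next
  case False
  define A where "A = {y. \<exists>x'. (x', y) \<in> p \<and> (x, x') \<in> E}"
  define B where "B = {y. \<exists>x'. (x', y) \<in> p \<and> (x, x') \<notin> E}"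
  have AB: "A \<union> B \<subseteq> snd ` p"
    by (force simp: A_def B_def)
  then have "finite A" "finite B"
    using p(2) by (meson finite_imageI finite_subset le_sup_iff)+
  moreover have "A \<subseteq> W" "B \<subseteq> W"
    using p(1) by (auto simp: A_def B_def partial_graph_iso_def)
  moreover have "A \<inter> B = {}"
    using p(1) by (fastforce simp: A_def B_def partial_graph_iso_def)
  ultimately obtain z where z: "z \<in> W" "z \<notin> A \<union> B" "\<forall>a\<in>A. (z, a) \<in> F" "\<forall>b\<in>B. (z, b) \<notin> F"
    using W unfolding ec_graph_def by meson
  have symE: "(a, b) \<in> E \<longleftrightarrow> (b, a) \<in> E" for a b
    using V by (auto simp: is_graph_def dest: symD)
  have symF: "(a, b) \<in> F \<longleftrightarrow> (b, a) \<in> F" for a b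
    using W by (auto simp: ec_graph_def is_graph_def dest: symD)
  have irr: "(a, a) \<notin> E" "(b, b) \<notin> F" for a b
    using V W by (auto simp: ec_graph_def is_graph_def irrefl_def)
  have new: "x \<noteq> x' \<and> z \<noteq> y' \<and> ((x, x') \<in> E \<longleftrightarrow> (z, y') \<in> F)" if "(x', y') \<in> p" for x' y'
    using that z False unfolding A_def B_def by blast
  have old: "(a = a' \<longleftrightarrow> b = b') \<and> ((a, a') \<in> E \<longleftrightarrow> (b, b') \<in> F)"
    if "(a, b) \<in> p" "(a', b') \<in> p" for a b a' b'
    using p(1) that unfolding partial_graph_iso_def by blast
  have "(a = a' \<longleftrightarrow> b = b') \<and> ((a, a') \<in> E \<longleftrightarrow> (b, b') \<in> F)"
    if "(a, b) \<in> insert (x, z) p" "(a', b') \<in> insert (x, z) p" for a b a' b'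
    using that old[of a b a' b'] new[of a b] new[of a' b'] irr(1)[of x] irr(2)[of z] symE[of x a] symF[of z b]
    by auto
  moreover have "insert (x, z) p \<subseteq> V \<times> W"
    using p(1) x z(1) by (auto simp: partial_graph_iso_def)
  ultimately have "partial_graph_iso V E W F (insert (x, z) p)"
    unfolding partial_graph_iso_def by blast
  then show ?thesis ..
qed

text \<open>Stage \<open>n\<close> puts the \<open>n\<close>-th vertex of each graph into a finite
  partial isomorphism, so the union of the chain is total and onto.\<close>

lemma ec_graph_unique:
  assumes V: "ec_graph V E" "countable V" and W: "ec_graph W F" "countable W"
  obtains \<phi> where "graph_iso V E W F \<phi>"
proof -
  have ne: "V \<noteq> {}" "W \<noteq> {}"
    using V(1) W(1) ec_graph_nonempty by auto
  have gr: "is_graph V E" "is_graph W F"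
    using V(1) W(1) by (auto simp: ec_graph_def)
  let ?P = "\<lambda>n p. finite p \<and> partial_graph_iso V E W F p"
  let ?Q = "\<lambda>n p q. p \<subseteq> q \<and> from_nat_into V n \<in> Domain q \<and> from_nat_into W n \<in> Range q"
  have "\<exists>p. \<forall>n. ?P n (p n) \<and> ?Q n (p n) (p (Suc n))"
  proof (rule dependent_nat_choice)
    show "\<exists>p. ?P 0 p"
      by (rule exI[of _ "{}"]) (simp add: partial_graph_iso_def)
    fix p and n :: nat assume p: "?P n p"
    obtain y where y: "partial_graph_iso V E W F (insert (from_nat_into V n, y) p)"
      using partial_graph_iso_extend[OF gr(1) W(1)] p from_nat_into[OF ne(1)] by blast
    let ?p = "insert (from_nat_into V n, y) p"
    obtain x where x: "partial_graph_iso W F V E (insert (from_nat_into W n, x) (?p\<inverse>))"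
      using partial_graph_iso_extend[OF gr(2) V(1) partial_graph_iso_converse[OF y]] p
        from_nat_into[OF ne(2)] by auto
    have "(insert (from_nat_into W n, x) (?p\<inverse>))\<inverse> = insert (x, from_nat_into W n) ?p"
      by auto
    then have "partial_graph_iso V E W F (insert (x, from_nat_into W n) ?p)"
      using partial_graph_iso_converse[OF x] by metis
    then show "\<exists>q. ?P (Suc n) q \<and> ?Q n p q"
      using p by (intro exI[of _ "insert (x, from_nat_into W n) ?p"]) auto
  qed
  then obtain p where p: "\<And>n. partial_graph_iso V E W F (p n)" "\<And>n. p n \<subseteq> p (Suc n)"
      "\<And>n. from_nat_into V n \<in> Domain (p (Suc n))" "\<And>n. from_nat_into W n \<in> Range (p (Suc n))"
    by blast
  define r where "r = (\<Union>n. p n)"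
  have mono: "p m \<subseteq> p n" if "m \<le> n" for m n
    using p(2) that by (rule lift_Suc_mono_le)
  have r: "(x = x' \<longleftrightarrow> y = y') \<and> ((x, x') \<in> E \<longleftrightarrow> (y, y') \<in> F)"
    if xy: "(x, y) \<in> r" "(x', y') \<in> r" for x y x' y'
  proof -
    obtain m n where "(x, y) \<in> p m" "(x', y') \<in> p n"
      using xy by (auto simp: r_def)
    then have "(x, y) \<in> p (max m n)" "(x', y') \<in> p (max m n)"
      using mono[of m "max m n"] mono[of n "max m n"] by auto
    then show ?thesis
      using p(1)[of "max m n"] unfolding partial_graph_iso_def by blast
  qed
  have rVW: "r \<subseteq> V \<times> W"
    using p(1) by (auto simp: r_def partial_graph_iso_def)
  have dom: "\<exists>y. (x, y) \<in> r" if "x \<in> V" for x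
    using p(3)[of "to_nat_on V x"] from_nat_into_to_nat_on[OF V(2) that] by (auto simp: r_def)
  have ran: "\<exists>x. (x, y) \<in> r" if "y \<in> W" for y
    using p(4)[of "to_nat_on W y"] from_nat_into_to_nat_on[OF W(2) that] by (auto simp: r_def)
  obtain \<phi> where \<phi>: "\<And>x. x \<in> V \<Longrightarrow> (x, \<phi> x) \<in> r"
    using dom by metis
  have "graph_iso V E W F \<phi>"
    unfolding graph_iso_def bij_betw_def
  proof (intro conjI ballI)
    show "inj_on \<phi> V"
    proof (rule inj_onI)
      fix x y assume "x \<in> V" "y \<in> V" "\<phi> x = \<phi> y"
      then show "x = y" using r[OF \<phi> \<phi>] by blast
    qed
    show "\<phi> ` V = W"
    proof
      show "\<phi> ` V \<subseteq> W" using \<phi> rVW by blast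
      show "W \<subseteq> \<phi> ` V"
      proof
        fix y assume "y \<in> W"
        then obtain x where x: "(x, y) \<in> r" using ran by blast
        then have "x \<in> V" using rVW by blast
        then have "y = \<phi> x" using r[OF x \<phi>] by blast
        then show "y \<in> \<phi> ` V" using \<open>x \<in> V\<close> by blast
      qed
    qed
    show "(\<phi> x, \<phi> y) \<in> F \<longleftrightarrow> (x, y) \<in> E" if "x \<in> V" "y \<in> V" for x y
      using r[OF \<phi>[OF that(1)] \<phi>[OF that(2)]] by blast
  qed
  then show thesis by (rule that)
qed

lemma graph_iso_inv:
  assumes "graph_iso V E W F \<phi>"
  shows "graph_iso W F V E (inv_into V \<phi>)"
proof -
  have bij: "bij_betw \<phi> V W" and adj: "\<And>x y. x \<in> V \<Longrightarrow> y \<in> V \<Longrightarrow> (\<phi> x, \<phi> y) \<in> F \<longleftrightarrow> (x, y) \<in> E"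
    using assms by (auto simp: graph_iso_def)
  have "inv_into V \<phi> x \<in> V" "\<phi> (inv_into V \<phi> x) = x" if "x \<in> W" for x
    using bij that by (auto simp: bij_betw_def inv_into_into f_inv_into_f)
  then show ?thesis
    unfolding graph_iso_def using bij_betw_inv_into[OF bij] by (simp flip: adj)
qed

lemma graph_iso_trans:
  assumes "graph_iso V E W F \<phi>" "graph_iso W F U G \<psi>"
  shows "graph_iso V E U G (\<lambda>x. \<psi> (\<phi> x))"
  using assms bij_betw_trans[of \<phi> V W \<psi> U] unfolding graph_iso_def
  by (auto simp: o_def bij_betw_apply)

section \<open>Hereditarily finite sets over a graph\<close>

datatype 'x hf = Atom 'x | HSet "'x hf fset"

definition hmem :: "'x hf \<Rightarrow> 'x hf \<Rightarrow> bool" where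
  "hmem x y \<longleftrightarrow> (\<exists>s. y = HSet s \<and> x |\<in>| s)"

lemma hmem_simps [simp]: "\<not> hmem x (Atom a)" "hmem x (HSet s) \<longleftrightarrow> x |\<in>| s"
  by (simp_all add: hmem_def)

text \<open>The set function \<open>set_hf\<close> of the datatype collects the urelements at all
  depths of nesting.\<close>

definition hf_over :: "'x set \<Rightarrow> 'x hf set" where
  "hf_over X = {x. set_hf x \<subseteq> X}"

lemma hf_over_simps [simp]:
  "Atom a \<in> hf_over X \<longleftrightarrow> a \<in> X"
  "HSet s \<in> hf_over X \<longleftrightarrow> fset s \<subseteq> hf_over X"
  by (auto simp: hf_over_def)

text \<open>Symmetrised membership, as in Ackermann's model of the Rado graph, over urelements that
  keep the edges of \<open>G\<close>.\<close>

definition hf_edges :: "'x set \<Rightarrow> ('x \<times> 'x) set \<Rightarrow> ('x hf \<times> 'x hf) set" where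
  "hf_edges X G = {(x, y). x \<in> hf_over X \<and> y \<in> hf_over X \<and>
     ((\<exists>a b. x = Atom a \<and> y = Atom b \<and> (a, b) \<in> G) \<or> hmem x y \<or> hmem y x)}"

text \<open>The weight \<open>w\<close> assigns ranks to the atoms. The inserted 0 gives the empty
  set rank 1, so every set has positive rank.\<close>

primrec hrank :: "('x \<Rightarrow> nat) \<Rightarrow> 'x hf \<Rightarrow> nat" where
  "hrank w (Atom a) = w a"
| "hrank w (HSet s) = Suc (Max (insert 0 (fset (fimage (hrank w) s))))"

lemma hrank_hmem: "hmem x y \<Longrightarrow> hrank w x < hrank w y"
proof -
  assume "hmem x y"
  then obtain s where s: "y = HSet s" "x \<in> fset s"
    by (auto simp: hmem_def)
  then have "hrank w x \<le> Max (insert 0 (fset (fimage (hrank w) s)))"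
    by (intro Max_ge) simp_all
  then show ?thesis
    by (simp add: s(1))
qed

lemma hrank_map: "hrank w (map_hf g x) = hrank (\<lambda>a. w (g a)) x"
proof (induction x)
  case (HSet s)
  then have "hrank w ` map_hf g ` fset s = hrank (\<lambda>a. w (g a)) ` fset s"
    by (simp add: image_image)
  then show ?case
    by (simp add: image_image)
qed simp

text \<open>Zermelo's numerals: sets without atoms, whose rank does not depend on the
  weights.\<close>

primrec tower :: "nat \<Rightarrow> 'x hf" where
  "tower 0 = HSet {||}"
| "tower (Suc n) = HSet {|tower n|}"

lemma hrank_tower [simp]: "hrank w (tower n) = Suc n"
  by (induction n) auto

lemma tower_hf_over [simp]: "tower n \<in> hf_over X"
  by (induction n) auto

lemma tower_not_Atom [simp]: "tower n \<noteq> Atom a" "Atom a \<noteq> tower n"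
  by (cases n; simp)+

text \<open>The new vertex is the set \<open>A\<close> enlarged by a tower of rank above all of
  \<open>A \<union> B\<close>. The tower lifts the rank of the new set above theirs, so no member of
  \<open>B\<close> contains it, and the tower itself does not lie in \<open>B\<close>.\<close>

lemma ec_graph_hf:
  assumes "is_graph X G"
  shows "ec_graph (hf_over X) (hf_edges X G)"
proof -
  let ?rk = "hrank (\<lambda>_. 0)"
  have "\<not> hmem x x" for x :: "'a hf"
    using hrank_hmem[of x x "\<lambda>_. 0"] by auto
  then have "is_graph (hf_over X) (hf_edges X G)"
    using assms by (auto simp: is_graph_def hf_edges_def irrefl_def sym_def)
  moreover have "\<exists>z\<in>hf_over X. z \<notin> A \<union> B \<and> (\<forall>a\<in>A. (z, a) \<in> hf_edges X G) \<and>
      (\<forall>b\<in>B. (z, b) \<notin> hf_edges X G)"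
    if fin: "finite A" "finite B" and sub: "A \<subseteq> hf_over X" "B \<subseteq> hf_over X" and disj: "A \<inter> B = {}"
    for A B
  proof -
    define N where "N = Max (insert 0 (?rk ` (A \<union> B)))"
    have N: "?rk x \<le> N" if "x \<in> A \<union> B" for x
      unfolding N_def using fin that by (intro Max_ge) auto
    define z where "z = HSet (finsert (tower N) (Abs_fset A))"
    have mem: "hmem x z \<longleftrightarrow> x = tower N \<or> x \<in> A" for x
      using fin by (simp add: z_def Abs_fset_inverse)
    have rk: "N < ?rk z"
      using hrank_hmem[of "tower N" z "\<lambda>_. 0"] mem by simp
    have "z \<in> hf_over X"
      using fin sub by (simp add: z_def Abs_fset_inverse)
    moreover have "z \<notin> A \<union> B"
      using N rk by fastforce
    moreover have "(z, a) \<in> hf_edges X G" if "a \<in> A" for a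
      using that mem sub \<open>z \<in> hf_over X\<close> by (auto simp: hf_edges_def)
    moreover have "(z, b) \<notin> hf_edges X G" if "b \<in> B" for b
    proof -
      have "\<not> hmem z b"
        using N[of b] that rk hrank_hmem[of z b "\<lambda>_. 0"] by auto
      moreover have "\<not> hmem b z"
        using N[of b] that mem disj by auto
      ultimately show ?thesis
        by (auto simp: hf_edges_def z_def)
    qed
    ultimately show ?thesis by blast
  qed
  ultimately show ?thesis
    by (simp add: ec_graph_def)
qed

text \<open>Induction on the rank with all atoms at rank 0: a set of rank at most
  \<open>Suc n\<close> is a finite subset of the countable set of elements of rank at most
  \<open>n\<close>.\<close>

lemma countable_hf_over:
  assumes "countable X"
  shows "countable (hf_over X)"
proof -
  let ?rk = "hrank (\<lambda>_. 0)"
  have "countable {x \<in> hf_over X. ?rk x \<le> n}" for n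
  proof (induction n)
    case 0
    have "{x \<in> hf_over X. ?rk x \<le> 0} \<subseteq> Atom ` X"
    proof
      fix x assume "x \<in> {x \<in> hf_over X. ?rk x \<le> 0}"
      then show "x \<in> Atom ` X" by (cases x) auto
    qed
    then show ?case using assms by (meson countable_image countable_subset)
  next
    case (Suc n)
    let ?L = "{x \<in> hf_over X. ?rk x \<le> n}"
    have "{x \<in> hf_over X. ?rk x \<le> Suc n} \<subseteq> Atom ` X \<union> (HSet \<circ> Abs_fset) ` {A. finite A \<and> A \<subseteq> ?L}"
    proof
      fix x assume x: "x \<in> {x \<in> hf_over X. ?rk x \<le> Suc n}"
      show "x \<in> Atom ` X \<union> (HSet \<circ> Abs_fset) ` {A. finite A \<and> A \<subseteq> ?L}"
      proof (cases x)
        case (HSet s)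
        have "fset s \<subseteq> ?L"
        proof
          fix y assume y: "y \<in> fset s"
          then have "?rk y < ?rk x"
            using HSet by (intro hrank_hmem) simp
          then show "y \<in> ?L" using x y HSet by auto
        qed
        then show ?thesis
          using HSet by (intro UnI2 image_eqI[of _ _ "fset s"]) (auto simp: fset_inverse)
      qed (use x in auto)
    qed
    moreover have "countable {A. finite A \<and> A \<subseteq> ?L}"
      using Suc by (rule countable_Collect_finite_subset)
    ultimately show ?case
      using assms by (meson countable_Un countable_image countable_subset)
  qed
  then have "countable (\<Union>n. {x \<in> hf_over X. ?rk x \<le> n})"
    by simp
  moreover have "(\<Union>n. {x \<in> hf_over X. ?rk x \<le> n}) = hf_over X"
    by auto
  ultimately show ?thesis by simp
qed

section \<open>Functoriality of the membership graph\<close>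

lemma map_hf_cong_over:
  assumes "x \<in> hf_over X" "\<And>a. a \<in> X \<Longrightarrow> g a = h a"
  shows "map_hf g x = map_hf h x"
  using assms by (intro hf.map_cong) (auto simp: hf_over_def)

text \<open>The inverse map is induced by the inverse of \<open>\<theta>\<close>, and injectivity on
  \<open>hf_over X\<close> makes membership reflected as well as preserved.\<close>

lemma graph_iso_map_hf:
  assumes "graph_iso X G Y H \<theta>"
  shows "graph_iso (hf_over X) (hf_edges X G) (hf_over Y) (hf_edges Y H) (map_hf \<theta>)"
proof -
  let ?\<eta> = "inv_into X \<theta>"
  have bij: "bij_betw \<theta> X Y" and adj: "\<And>x y. x \<in> X \<Longrightarrow> y \<in> X \<Longrightarrow> (\<theta> x, \<theta> y) \<in> H \<longleftrightarrow> (x, y) \<in> G"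
    using assms by (auto simp: graph_iso_def)
  have 1: "map_hf ?\<eta> (map_hf \<theta> x) = x" if "x \<in> hf_over X" for x
    using map_hf_cong_over[OF that, of "?\<eta> \<circ> \<theta>" id] bij
    by (simp add: hf.map_comp hf.map_id bij_betw_inv_into_left)
  have 2: "map_hf \<theta> (map_hf ?\<eta> y) = y" if "y \<in> hf_over Y" for y
    using map_hf_cong_over[OF that, of "\<theta> \<circ> ?\<eta>" id] bij
    by (simp add: hf.map_comp hf.map_id bij_betw_inv_into_right)
  have 3: "map_hf \<theta> x \<in> hf_over Y" if "x \<in> hf_over X" for x
    using that bij by (auto simp: hf_over_def hf.set_map bij_betw_def)
  have 4: "map_hf ?\<eta> y \<in> hf_over X" if "y \<in> hf_over Y" for y
    using that bij_betw_inv_into[OF bij] by (auto simp: hf_over_def hf.set_map bij_betw_def)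
  have bij': "bij_betw (map_hf \<theta>) (hf_over X) (hf_over Y)"
    by (rule bij_betw_byWitness[where f' = "map_hf ?\<eta>"]) (use 1 2 3 4 in auto)
  have mem: "hmem (map_hf \<theta> x) (map_hf \<theta> y) \<longleftrightarrow> hmem x y" if x: "x \<in> hf_over X" and y: "y \<in> hf_over X" for x y
  proof (cases y)
    case (HSet s)
    have "map_hf \<theta> x \<in> map_hf \<theta> ` fset s \<longleftrightarrow> x \<in> fset s"
      using bij' x y HSet by (intro inj_on_image_mem_iff) (auto simp: bij_betw_def)
    then show ?thesis using HSet by simp
  qed simp
  have atom: "(\<exists>a b. map_hf \<theta> x = Atom a \<and> map_hf \<theta> y = Atom b \<and> (a, b) \<in> H) \<longleftrightarrow>
      (\<exists>a b. x = Atom a \<and> y = Atom b \<and> (a, b) \<in> G)" if "x \<in> hf_over X" "y \<in> hf_over X" for x y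
    using that by (cases x; cases y) (simp_all add: adj)
  show ?thesis
    unfolding graph_iso_def using bij' 3 mem atom by (simp add: hf_edges_def)
qed

section \<open>Rigid marking\<close>

abbreviation clock :: "nat \<Rightarrow> ('a + nat) hf" where
  "clock n \<equiv> Atom (Inr n)"

abbreviation point :: "'a \<Rightarrow> ('a + nat) hf" where
  "point v \<equiv> Atom (Inl v)"

definition crank :: "('a + nat) hf \<Rightarrow> nat" where
  "crank = hrank (case_sum (\<lambda>_. 0) id)"

lemma crank_simps [simp]:
  "crank (clock n) = n" "crank (point v) = 0" "crank (tower n) = Suc n" "crank (HSet s) \<noteq> 0"
  by (simp_all add: crank_def)

lemma crank_hmem: "hmem x y \<Longrightarrow> crank x < crank y"
  unfolding crank_def by (rule hrank_hmem)

definition verts :: "'a set \<Rightarrow> ('a + nat) hf set" where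
  "verts V = hf_over (V <+> UNIV)"

lemma verts_simps [simp]:
  "clock n \<in> verts V" "point v \<in> verts V \<longleftrightarrow> v \<in> V" "tower n \<in> verts V"
  "HSet s \<in> verts V \<longleftrightarrow> fset s \<subseteq> verts V"
  by (auto simp: verts_def)

definition base_edges :: "'a set \<Rightarrow> (('a + nat) hf \<times> ('a + nat) hf) set" where
  "base_edges V = hf_edges (V <+> UNIV) {}"

lemma base_edges_iff:
  "(x, y) \<in> base_edges V \<longleftrightarrow> x \<in> verts V \<and> y \<in> verts V \<and> (hmem x y \<or> hmem y x)"
  by (auto simp: base_edges_def hf_edges_def verts_def)

text \<open>An edge forgets the direction of membership; the rank restores it, since members have
  smaller rank. A map preserving base edges and ranks therefore preserves membership.\<close>

lemma hmem_iff_base_edges: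
  assumes "x \<in> verts V" "y \<in> verts V"
  shows "hmem x y \<longleftrightarrow> (x, y) \<in> base_edges V \<and> crank x < crank y"
  using assms crank_hmem[of x y] crank_hmem[of y x] by (auto simp: base_edges_iff)

text \<open>The clocks make ranks visible: the \<open>n\<close>-th clock has rank \<open>n\<close>, so a set containing it has
  rank above \<open>n\<close>, and adding all pairs of the \<open>n\<close>-th clock with a non-clock of rank above \<open>n\<close>
  makes its marked neighbourhood, apart from clocks, exactly the non-clocks of rank above \<open>n\<close>.
  The set \<open>S\<close> is recorded in the pairs of consecutive clocks.\<close>

definition mark :: "('a \<times> 'a) set \<Rightarrow> nat set \<Rightarrow> ('a + nat) hf \<Rightarrow> ('a + nat) hf \<Rightarrow> bool" where
  "mark E S x y \<longleftrightarrow>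
     (\<exists>n. x = clock n \<and> y \<notin> range clock \<and> n < crank y) \<or>
     (\<exists>u v. x = point u \<and> y = point v \<and> (u, v) \<in> E) \<or>
     (\<exists>n\<in>S. x = clock n \<and> y = clock (Suc n))"

definition marked_edges ::
  "'a set \<Rightarrow> ('a \<times> 'a) set \<Rightarrow> nat set \<Rightarrow> (('a + nat) hf \<times> ('a + nat) hf) set" where
  "marked_edges V E S = base_edges V \<union>
     {(x, y). x \<in> verts V \<and> y \<in> verts V \<and> (mark E S x y \<or> mark E S y x)}"

section \<open>Adjacency in the marked graph\<close>

lemma marked_edges_sym: "(x, y) \<in> marked_edges V E S \<longleftrightarrow> (y, x) \<in> marked_edges V E S"
  by (auto simp: marked_edges_def base_edges_iff)

text \<open>A base edge between a clock and a non-clock \<open>y\<close> is a membership of the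
  clock in \<open>y\<close>, which already forces \<open>n < crank y\<close>; so base edges do not
  blur the marking.\<close>

lemma marked_edges_clock:
  assumes "y \<in> verts V" "y \<notin> range clock"
  shows "(y, clock n) \<in> marked_edges V E S \<longleftrightarrow> n < crank y"
  using assms crank_hmem[of "clock n" y] by (auto simp: marked_edges_def base_edges_iff mark_def)

lemma marked_edges_clocks: "(clock n, clock (Suc n)) \<in> marked_edges V E S \<longleftrightarrow> n \<in> S"
  by (auto simp: marked_edges_def base_edges_iff mark_def)

lemma marked_edges_points:
  assumes "sym E" "u \<in> V" "v \<in> V"
  shows "(point u, point v) \<in> marked_edges V E S \<longleftrightarrow> (u, v) \<in> E"
  using assms by (auto simp: marked_edges_def base_edges_iff mark_def dest: symD)

lemma marked_edges_HSet:
  assumes "y \<notin> range clock"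
  shows "(HSet s, y) \<in> marked_edges V E S \<longleftrightarrow> (HSet s, y) \<in> base_edges V"
  using assms by (auto simp: marked_edges_def mark_def)

lemma base_edges_graph: "is_graph (verts V) (base_edges V)"
proof -
  have "is_graph (V <+> (UNIV :: nat set)) {}"
    by (simp add: is_graph_def irrefl_def sym_def)
  from ec_graph_hf[OF this] show ?thesis
    by (simp add: ec_graph_def verts_def base_edges_def)
qed

lemma marked_edges_graph:
  assumes "is_graph V E"
  shows "is_graph (verts V) (marked_edges V E S)"
proof -
  have "(x, x) \<notin> marked_edges V E S" for x
    using assms base_edges_graph[of V]
    by (auto simp: marked_edges_def mark_def is_graph_def irrefl_def)
  then show ?thesis
    using base_edges_graph[of V] marked_edges_sym[of _ _ V E S]
    by (auto simp: is_graph_def irrefl_def sym_def marked_edges_def)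
qed

section \<open>Definability of the clocks, and rigidity\<close>

lemma clock_characterization:
  assumes y: "y \<in> verts V"
  shows "y \<in> range clock \<longleftrightarrow>
    (\<exists>z\<in>verts V. z \<noteq> y \<and> (\<forall>w\<in>verts V. (w, z) \<in> base_edges V \<longrightarrow> (w, y) \<in> marked_edges V E S))"
proof
  assume "y \<in> range clock"
  then obtain n where n: "y = clock n" by blast
  \<comment> \<open>For \<open>clock n\<close> the other vertex is \<open>tower (Suc n)\<close>: its
    base neighbours are \<open>tower n\<close> and the sets containing it, all of rank above
    \<open>n\<close>.\<close>
  have "(w, clock n) \<in> marked_edges V E S" if w: "w \<in> verts V" "(w, tower (Suc n)) \<in> base_edges V" for w
  proof -
    have "w = tower n \<or> hmem (tower (Suc n)) w"
      using w by (auto simp: base_edges_iff)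
    then have "w \<notin> range clock \<and> n < crank w"
      using crank_hmem[of "tower (Suc n)" w] by (auto simp del: tower.simps)
    then show ?thesis
      using w(1) marked_edges_clock by blast
  qed
  then show "\<exists>z\<in>verts V. z \<noteq> y \<and> (\<forall>w\<in>verts V. (w, z) \<in> base_edges V \<longrightarrow> (w, y) \<in> marked_edges V E S)"
    unfolding n by (intro bexI[of _ "tower (Suc n)"]) (auto simp del: tower.simps)
next
  assume "\<exists>z\<in>verts V. z \<noteq> y \<and> (\<forall>w\<in>verts V. (w, z) \<in> base_edges V \<longrightarrow> (w, y) \<in> marked_edges V E S)"
  then obtain z where z: "z \<in> verts V" "z \<noteq> y"
    and nb: "\<And>w. w \<in> verts V \<Longrightarrow> (w, z) \<in> base_edges V \<Longrightarrow> (w, y) \<in> marked_edges V E S"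
    by blast
  show "y \<in> range clock"
  proof (rule ccontr)
    assume nc: "y \<notin> range clock"
    \<comment> \<open>This set is a base neighbour of \<open>z\<close>. The tower has rank
      \<open>Suc (crank y)\<close>, so it differs from \<open>y\<close> and makes the set too high
      to be a member of \<open>y\<close>; hence the set is not adjacent to \<open>y\<close>.\<close>
    define s where "s = {|z, tower (crank y)|}"
    have w: "HSet s \<in> verts V" "(HSet s, z) \<in> base_edges V"
      using z(1) by (auto simp: s_def base_edges_iff)
    have "(HSet s, y) \<in> base_edges V"
      using nb[OF w] marked_edges_HSet[OF nc] by blast
    moreover have "crank y < crank (HSet s)"
      using crank_hmem[of "tower (crank y)" "HSet s"] by (simp add: s_def)
    ultimately have "hmem y (HSet s)"
      using crank_hmem[of "HSet s" y] by (auto simp: base_edges_iff)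
    then have "y = tower (crank y)"
      using z(2) by (auto simp: s_def)
    then have "crank y = Suc (crank y)"
      by (metis crank_simps(3))
    then show False by simp
  qed
qed

text \<open>The marked neighbours of \<open>clock n\<close> among non-clocks are those of rank above
  \<open>n\<close>, a decreasing chain in \<open>n\<close>. For the converse, \<open>tower m\<close>
  has rank \<open>Suc m\<close> and is adjacent to \<open>clock m\<close>.\<close>

lemma clock_order:
  "n \<le> m \<longleftrightarrow> (\<forall>y\<in>verts V. y \<notin> range clock \<longrightarrow>
     (y, clock m) \<in> marked_edges V E S \<longrightarrow> (y, clock n) \<in> marked_edges V E S)"
proof
  assume "n \<le> m"
  then show "\<forall>y\<in>verts V. y \<notin> range clock \<longrightarrow>
     (y, clock m) \<in> marked_edges V E S \<longrightarrow> (y, clock n) \<in> marked_edges V E S"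
    by (auto simp: marked_edges_clock)
next
  assume *: "\<forall>y\<in>verts V. y \<notin> range clock \<longrightarrow>
     (y, clock m) \<in> marked_edges V E S \<longrightarrow> (y, clock n) \<in> marked_edges V E S"
  have t: "tower m \<in> verts V" "tower m \<notin> range clock"
    by auto
  with * show "n \<le> m"
    using marked_edges_clock[OF t, of m E S] marked_edges_clock[OF t, of n E S] by auto
qed

text \<open>A strictly increasing map on the naturals satisfies \<open>n \<le> \<pi> n\<close>; this
  applies to \<open>\<pi>\<close> and to its inverse.\<close>

lemma order_automorphism_nat:
  fixes \<pi> :: "nat \<Rightarrow> nat"
  assumes "surj \<pi>" "\<And>n m. n \<le> m \<longleftrightarrow> \<pi> n \<le> \<pi> m"
  shows "\<pi> n = n"
proof -
  have mono: "strict_mono \<pi>"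
    using assms(2) by (simp add: strict_mono_def not_le[symmetric])
  have "strict_mono (inv_into UNIV \<pi>)"
    unfolding strict_mono_def not_le[symmetric]
    using assms(2)[of "inv_into UNIV \<pi> _" "inv_into UNIV \<pi> _"] by (simp add: surj_f_inv_f[OF assms(1)])
  then have "n \<le> inv_into UNIV \<pi> n"
    by (rule strict_mono_imp_increasing)
  then have "\<pi> n \<le> n"
    using assms by (metis surj_f_inv_f)
  moreover have "n \<le> \<pi> n"
    using mono by (rule strict_mono_imp_increasing)
  ultimately show ?thesis by simp
qed

text \<open>The clocks and their order are definable from the two edge relations, so every clock is
  fixed. Fixed clocks reveal \<open>S\<close>, then the rank of every vertex, then the points and
  the direction of membership, so that \<open>\<sigma>\<close> is determined by its action on the
  points.\<close>

lemma marked_iso_rigid: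
  assumes E: "sym E"
    and base: "graph_iso (verts V) (base_edges V) (verts V) (base_edges V) \<sigma>"
    and marked: "graph_iso (verts V) (marked_edges V E S) (verts V) (marked_edges V E S') \<sigma>"
  shows "S = S'"
    and "\<exists>\<tau>\<in>carrier (Aut_graph V E). \<forall>x\<in>verts V. \<sigma> x = map_hf (map_sum \<tau> id) x"
proof -
  have bij: "bij_betw \<sigma> (verts V) (verts V)"
    and b: "\<And>x y. x \<in> verts V \<Longrightarrow> y \<in> verts V \<Longrightarrow> (\<sigma> x, \<sigma> y) \<in> base_edges V \<longleftrightarrow> (x, y) \<in> base_edges V"
    and m: "\<And>x y. x \<in> verts V \<Longrightarrow> y \<in> verts V \<Longrightarrow>
      (\<sigma> x, \<sigma> y) \<in> marked_edges V E S' \<longleftrightarrow> (x, y) \<in> marked_edges V E S"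
    using base marked by (auto simp: graph_iso_def)
  have \<sigma>V: "\<sigma> x \<in> verts V" if "x \<in> verts V" for x
    using bij that by (auto simp: bij_betw_def)
  have \<sigma>eq: "\<sigma> x = \<sigma> y \<longleftrightarrow> x = y" if "x \<in> verts V" "y \<in> verts V" for x y
    using bij that by (auto simp: bij_betw_def inj_on_def)
  \<comment> \<open>Quantifiers over \<open>verts V\<close> are invariant under the bijection
    \<open>\<sigma>\<close>, which lets it carry the definitions of clocks and of their
    order.\<close>
  have all: "(\<forall>x\<in>verts V. Q (\<sigma> x)) \<longleftrightarrow> (\<forall>x\<in>verts V. Q x)" for Q
    using bij by (metis (mono_tags, lifting) bij_betw_def image_iff)
  have ex: "(\<exists>x\<in>verts V. Q (\<sigma> x)) \<longleftrightarrow> (\<exists>x\<in>verts V. Q x)" for Q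
    using bij by (metis (mono_tags, lifting) bij_betw_def image_iff)
  have clk: "\<sigma> y \<in> range clock \<longleftrightarrow> y \<in> range clock" if y: "y \<in> verts V" for y
  proof -
    have "\<sigma> y \<in> range clock \<longleftrightarrow> (\<exists>z\<in>verts V. \<sigma> z \<noteq> \<sigma> y \<and>
        (\<forall>w\<in>verts V. (\<sigma> w, \<sigma> z) \<in> base_edges V \<longrightarrow> (\<sigma> w, \<sigma> y) \<in> marked_edges V E S'))"
      unfolding clock_characterization[OF \<sigma>V[OF y], where E = E and S = S']
      by (subst ex[symmetric], subst all[symmetric]) (rule refl)
    also have "\<dots> \<longleftrightarrow> y \<in> range clock"
      unfolding clock_characterization[OF y, where E = E and S = S]
      using y by (simp add: b m \<sigma>eq cong: conj_cong)
    finally show ?thesis .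
  qed
  have "\<exists>k. \<sigma> (clock n) = clock k" for n
    using clk[of "clock n"] by auto
  then obtain \<pi> where \<pi>: "\<And>n. \<sigma> (clock n) = clock (\<pi> n)"
    by metis
  have "surj \<pi>"
    unfolding surj_def
  proof
    fix k
    obtain y where y: "y \<in> verts V" "\<sigma> y = clock k"
      using bij unfolding bij_betw_def by (metis imageE verts_simps(1))
    then obtain n where "y = clock n"
      using clk[OF y(1)] by auto
    then show "\<exists>n. k = \<pi> n"
      using y(2) \<pi> by auto
  qed
  moreover have "n \<le> l \<longleftrightarrow> \<pi> n \<le> \<pi> l" for n l
  proof -
    have "\<pi> n \<le> \<pi> l \<longleftrightarrow> (\<forall>y\<in>verts V. \<sigma> y \<notin> range clock \<longrightarrow>
        (\<sigma> y, \<sigma> (clock l)) \<in> marked_edges V E S' \<longrightarrow> (\<sigma> y, \<sigma> (clock n)) \<in> marked_edges V E S')"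
      unfolding \<pi> clock_order[of "\<pi> n" "\<pi> l" V E S'] by (subst all[symmetric]) (rule refl)
    also have "\<dots> \<longleftrightarrow> n \<le> l"
      unfolding clock_order[of n l V E S] by (simp add: m clk)
    finally show ?thesis by simp
  qed
  ultimately have "\<pi> n = n" for n
    by (rule order_automorphism_nat)
  then have fix_clock: "\<sigma> (clock n) = clock n" for n
    using \<pi> by simp
  show "S = S'"
  proof (rule Set.set_eqI)
    fix n
    show "n \<in> S \<longleftrightarrow> n \<in> S'"
      using m[of "clock n" "clock (Suc n)"] by (simp add: fix_clock marked_edges_clocks)
  qed
  \<comment> \<open>The rank of a non-clock is the number of clocks adjacent to it in the marked
    graph.\<close>
  have rank: "crank (\<sigma> x) = crank x" if x: "x \<in> verts V" for x
  proof (cases "x \<in> range clock")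
    case True
    then show ?thesis using fix_clock by auto
  next
    case False
    have "n < crank (\<sigma> x) \<longleftrightarrow> n < crank x" for n
      using m[OF x, of "clock n"] x False clk[OF x] \<sigma>V[OF x]
      by (simp add: fix_clock marked_edges_clock)
    then show ?thesis
      by (metis linorder_neq_iff)
  qed
  \<comment> \<open>Sets have positive rank, which separates them from the points.\<close>
  have point_iff: "x \<in> point ` V \<longleftrightarrow> x \<notin> range clock \<and> crank x = 0" if "x \<in> verts V" for x
  proof (cases x)
    case (Atom a)
    then show ?thesis using that by (cases a) auto
  qed auto
  have pt: "\<sigma> x \<in> point ` V \<longleftrightarrow> x \<in> point ` V" if "x \<in> verts V" for x
    using that point_iff \<sigma>V clk rank by simp
  have "\<exists>u\<in>V. \<sigma> (point v) = point u" if "v \<in> V" for v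
    using pt[of "point v"] that by auto
  then obtain \<tau>0 where \<tau>0: "\<And>v. v \<in> V \<Longrightarrow> \<tau>0 v \<in> V \<and> \<sigma> (point v) = point (\<tau>0 v)"
    by metis
  define \<tau> where "\<tau> = restrict \<tau>0 V"
  have \<tau>: "\<tau> v \<in> V" "\<sigma> (point v) = point (\<tau> v)" if "v \<in> V" for v
    using \<tau>0 that by (auto simp: \<tau>_def)
  have "\<tau> \<in> carrier (Aut_graph V E)"
  proof -
    have "inj_on \<tau> V"
    proof (rule inj_onI)
      fix u v assume uv: "u \<in> V" "v \<in> V" "\<tau> u = \<tau> v"
      then have "\<sigma> (point u) = \<sigma> (point v)" using \<tau> by simp
      then show "u = v" using \<sigma>eq[of "point u" "point v"] uv by simp
    qed
    moreover have "\<tau> ` V = V"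
    proof
      show "\<tau> ` V \<subseteq> V" using \<tau>(1) by blast
      show "V \<subseteq> \<tau> ` V"
      proof
        fix u assume u: "u \<in> V"
        then obtain x where x: "x \<in> verts V" "\<sigma> x = point u"
          using bij unfolding bij_betw_def by (metis imageE verts_simps(2))
        then obtain v where "x = point v" "v \<in> V"
          using pt[OF x(1)] u by auto
        then show "u \<in> \<tau> ` V" using x(2) \<tau>(2) by auto
      qed
    qed
    moreover have "(u, v) \<in> E \<longleftrightarrow> (\<tau> u, \<tau> v) \<in> E" if "u \<in> V" "v \<in> V" for u v
      using m[of "point u" "point v"] that marked_edges_points[OF E] \<tau> by simp
    ultimately show ?thesis
      by (simp add: Aut_graph_def bij_betw_def \<tau>_def)
  qed
  \<comment> \<open>Induction on membership: on atoms the claim is known, and a set goes to the set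
    of the images of its members.\<close>
  moreover have "\<sigma> x = map_hf (map_sum \<tau> id) x" if "x \<in> verts V" for x
    using that
  proof (induction x)
    case (Atom a)
    then show ?case using \<tau>(2) fix_clock by (cases a) auto
  next
    case (HSet s)
    have sub: "fset s \<subseteq> verts V" using HSet.prems by simp
    have IH: "\<sigma> ` fset s = map_hf (map_sum \<tau> id) ` fset s"
      by (intro image_cong refl HSet.IH subsetD[OF sub])
    \<comment> \<open>Being neither a clock nor of rank 0 like the points, the image of a set is a
      set.\<close>
    have "\<sigma> (HSet s) \<notin> range clock" "crank (\<sigma> (HSet s)) \<noteq> 0"
      using clk[OF HSet.prems] rank[OF HSet.prems] by auto
    then obtain s' where s': "\<sigma> (HSet s) = HSet s'"
    proof (cases "\<sigma> (HSet s)")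
      case (Atom a)
      with \<open>\<sigma> (HSet s) \<notin> range clock\<close> \<open>crank (\<sigma> (HSet s)) \<noteq> 0\<close> show ?thesis
        by (cases a) auto
    qed (rule that)
    have sub': "fset s' \<subseteq> verts V"
      using \<sigma>V[OF HSet.prems] s' by simp
    have mem: "\<sigma> x \<in> fset s' \<longleftrightarrow> x \<in> fset s" if x: "x \<in> verts V" for x
    proof -
      have "\<sigma> x \<in> fset s' \<longleftrightarrow> hmem (\<sigma> x) (\<sigma> (HSet s))" by (simp add: s')
      also have "\<dots> \<longleftrightarrow> hmem x (HSet s)"
        by (simp only: hmem_iff_base_edges[OF x HSet.prems] b[OF x HSet.prems]
            hmem_iff_base_edges[OF \<sigma>V[OF x] \<sigma>V[OF HSet.prems]] rank[OF x] rank[OF HSet.prems])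
      finally show ?thesis by simp
    qed
    have "fset s' = \<sigma> ` fset s"
    proof
      show "\<sigma> ` fset s \<subseteq> fset s'" using mem sub by blast
      show "fset s' \<subseteq> \<sigma> ` fset s"
      proof
        fix y assume y: "y \<in> fset s'"
        then obtain x where "x \<in> verts V" "y = \<sigma> x"
          using bij sub' unfolding bij_betw_def by blast
        then show "y \<in> \<sigma> ` fset s" using mem y by blast
      qed
    qed
    then have "s' = map_hf (map_sum \<tau> id) |`| s"
      using IH by (simp add: fset_inject[symmetric])
    then show ?case by (simp only: s' hf.map)
  qed
  ultimately show "\<exists>\<tau>\<in>carrier (Aut_graph V E). \<forall>x\<in>verts V. \<sigma> x = map_hf (map_sum \<tau> id) x"
    by blast
qed

text \<open>The lift fixes the clocks and preserves ranks, and by functoriality it preserves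
  membership. The marking depends only on these data and on \<open>E\<close>.\<close>

lemma lift_automorphism:
  assumes E: "sym E" and \<tau>: "\<tau> \<in> carrier (Aut_graph V E)"
  shows "graph_iso (verts V) (base_edges V) (verts V) (base_edges V) (map_hf (map_sum \<tau> id))"
    and "graph_iso (verts V) (marked_edges V E S) (verts V) (marked_edges V E S)
      (map_hf (map_sum \<tau> id))"
proof -
  let ?m = "map_hf (map_sum \<tau> (id :: nat \<Rightarrow> nat))"
  have bij: "bij_betw \<tau> V V" and adj: "\<And>x y. x \<in> V \<Longrightarrow> y \<in> V \<Longrightarrow> (x, y) \<in> E \<longleftrightarrow> (\<tau> x, \<tau> y) \<in> E"
    using \<tau> by (auto simp: Aut_graph_def)
  have "bij_betw (map_sum \<tau> (id :: nat \<Rightarrow> nat)) (V <+> UNIV) (V <+> UNIV)"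
    by (rule bij_betw_byWitness[where f' = "map_sum (inv_into V \<tau>) id"])
      (use bij bij_betw_inv_into[OF bij] in
        \<open>auto simp: bij_betw_inv_into_left bij_betw_inv_into_right bij_betw_apply\<close>)
  then have "graph_iso (V <+> UNIV) {} (V <+> UNIV) {} (map_sum \<tau> (id :: nat \<Rightarrow> nat))"
    by (simp add: graph_iso_def)
  from graph_iso_map_hf[OF this]
  show base: "graph_iso (verts V) (base_edges V) (verts V) (base_edges V) ?m"
    by (simp add: verts_def base_edges_def)
  have rank: "crank (?m x) = crank x" for x
  proof -
    have "(\<lambda>a. case_sum (\<lambda>_. 0) id (map_sum \<tau> id a)) = case_sum (\<lambda>_. 0) (id :: nat \<Rightarrow> nat)"
      by (auto split: sum.split)
    then show ?thesis by (simp add: crank_def hrank_map)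
  qed
  have clk: "?m x = clock n \<longleftrightarrow> x = clock n" for x n
  proof (cases x)
    case (Atom a)
    then show ?thesis by (cases a) auto
  qed auto
  have pt: "(\<exists>u v. ?m x = point u \<and> ?m y = point v \<and> (u, v) \<in> E) \<longleftrightarrow>
      (\<exists>u v. x = point u \<and> y = point v \<and> (u, v) \<in> E)" if xy: "x \<in> verts V" "y \<in> verts V" for x y
  proof -
    have 1: "(\<exists>u. ?m z = point u) \<longleftrightarrow> (\<exists>u. z = point u)" for z
    proof (cases z)
      case (Atom a)
      then show ?thesis by (cases a) auto
    qed auto
    show ?thesis
    proof (cases "(\<exists>u. x = point u) \<and> (\<exists>u. y = point u)")
      case True
      then obtain u v where uv: "x = point u" "y = point v" by blast
      then show ?thesis using xy adj[of u v] by simp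
    next
      case False
      then show ?thesis using 1[of x] 1[of y] by blast
    qed
  qed
  have mark: "mark E S (?m x) (?m y) \<longleftrightarrow> mark E S x y" if "x \<in> verts V" "y \<in> verts V" for x y
    unfolding mark_def pt[OF that] image_iff clk rank by (simp add: clk eq_commute[of "?m y"])
  show "graph_iso (verts V) (marked_edges V E S) (verts V) (marked_edges V E S) ?m"
    using base mark by (auto simp: graph_iso_def marked_edges_def bij_betw_apply)
qed

section \<open>Endomorphisms of the universal graph\<close>

lemma End_graph_carrier_iff:
  "f \<in> carrier (End_graph V E) \<longleftrightarrow>
     f \<in> V \<rightarrow>\<^sub>E V \<and> (\<forall>x\<in>V. \<forall>y\<in>V. (x, y) \<in> E \<longrightarrow> (f x, f y) \<in> E)"
  by (simp add: End_graph_def)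

lemma End_graph_mult: "f \<otimes>\<^bsub>End_graph V E\<^esub> g = compose V g f"
  by (simp add: End_graph_def)

lemma End_graph_mult_apply: "x \<in> V \<Longrightarrow> (f \<otimes>\<^bsub>End_graph V E\<^esub> g) x = g (f x)"
  by (simp add: End_graph_def compose_def)

lemma End_graph_one: "\<one>\<^bsub>End_graph V E\<^esub> = (\<lambda>x\<in>V. x)"
  by (simp add: End_graph_def)

lemma End_graph_eqI:
  assumes "f \<in> carrier (End_graph V E)" "g \<in> carrier (End_graph V E)" "\<And>x. x \<in> V \<Longrightarrow> f x = g x"
  shows "f = g"
  using assms by (auto simp: End_graph_carrier_iff intro: PiE_ext)

lemma End_graph_monoid: "monoid (End_graph V E)"
proof (rule monoidI)
  fix f g assume f: "f \<in> carrier (End_graph V E)" and g: "g \<in> carrier (End_graph V E)"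
  have "compose V g f x \<in> V" if "x \<in> V" for x
    using f g that by (auto simp: End_graph_carrier_iff compose_def)
  moreover have "(compose V g f x, compose V g f y) \<in> E" if "x \<in> V" "y \<in> V" "(x, y) \<in> E" for x y
    using f g that by (auto simp: End_graph_carrier_iff compose_def PiE_iff)
  ultimately show "f \<otimes>\<^bsub>End_graph V E\<^esub> g \<in> carrier (End_graph V E)"
    unfolding End_graph_carrier_iff End_graph_mult by (auto simp: PiE_iff)
next
  fix f g h assume "f \<in> carrier (End_graph V E)"
  then have "f \<in> V \<rightarrow> V" by (auto simp: End_graph_carrier_iff)
  then show "f \<otimes>\<^bsub>End_graph V E\<^esub> g \<otimes>\<^bsub>End_graph V E\<^esub> h = f \<otimes>\<^bsub>End_graph V E\<^esub> (g \<otimes>\<^bsub>End_graph V E\<^esub> h)"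
    unfolding End_graph_mult by (rule compose_assoc)
next
  fix f assume "f \<in> carrier (End_graph V E)"
  then have "f \<in> V \<rightarrow> V" "f \<in> extensional V" by (auto simp: End_graph_carrier_iff PiE_iff)
  then show "\<one>\<^bsub>End_graph V E\<^esub> \<otimes>\<^bsub>End_graph V E\<^esub> f = f" "f \<otimes>\<^bsub>End_graph V E\<^esub> \<one>\<^bsub>End_graph V E\<^esub> = f"
    unfolding End_graph_mult End_graph_one by (simp_all add: compose_Id Id_compose)
qed (auto simp: End_graph_carrier_iff End_graph_one)

text \<open>An inverse that is itself an endomorphism amounts to reflecting edges. Both structures
  have the same product and identity, so equality of the carriers suffices.\<close>

lemma Aut_graph_eq_units: "Aut_graph V E = units_of (End_graph V E)"
proof -
  have "f \<in> Units (End_graph V E)" if f: "f \<in> carrier (Aut_graph V E)" for f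
  proof -
    have bij: "bij_betw f V V" and ext: "f \<in> extensional V"
      and adj: "\<And>x y. x \<in> V \<Longrightarrow> y \<in> V \<Longrightarrow> (x, y) \<in> E \<longleftrightarrow> (f x, f y) \<in> E"
      using f by (auto simp: Aut_graph_def)
    define g where "g = restrict (inv_into V f) V"
    have gV: "g x \<in> V" "f (g x) = x" if "x \<in> V" for x
      using that bij by (auto simp: g_def bij_betw_def inv_into_into f_inv_into_f)
    have gf: "g (f x) = x" "f x \<in> V" if "x \<in> V" for x
      using that bij by (auto simp: g_def bij_betw_def)
    have "f \<in> carrier (End_graph V E)"
      using ext gf(2) adj by (auto simp: End_graph_carrier_iff PiE_iff)
    moreover have "g \<in> carrier (End_graph V E)"
    proof -
      have "(g x, g y) \<in> E" if "x \<in> V" "y \<in> V" "(x, y) \<in> E" for x y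
        using adj[of "g x" "g y"] gV that by simp
      moreover have "g \<in> extensional V"
        by (simp add: g_def)
      ultimately show ?thesis
        using gV(1) by (simp add: End_graph_carrier_iff PiE_iff)
    qed
    moreover have "g \<otimes>\<^bsub>End_graph V E\<^esub> f = \<one>\<^bsub>End_graph V E\<^esub>" "f \<otimes>\<^bsub>End_graph V E\<^esub> g = \<one>\<^bsub>End_graph V E\<^esub>"
      unfolding End_graph_mult End_graph_one compose_def using gV gf by (auto intro!: restrict_ext)
    ultimately show ?thesis
      unfolding Units_def by blast
  qed
  moreover have "f \<in> carrier (Aut_graph V E)" if f: "f \<in> Units (End_graph V E)" for f
  proof -
    obtain g where g: "g \<in> carrier (End_graph V E)" and fc: "f \<in> carrier (End_graph V E)"
      and gf: "g \<otimes>\<^bsub>End_graph V E\<^esub> f = \<one>\<^bsub>End_graph V E\<^esub>" and fg: "f \<otimes>\<^bsub>End_graph V E\<^esub> g = \<one>\<^bsub>End_graph V E\<^esub>"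
      using f by (auto simp: Units_def)
    have 1: "f (g x) = x" "g (f x) = x" if "x \<in> V" for x
      using fun_cong[OF gf, of x] fun_cong[OF fg, of x] that
      by (simp_all add: End_graph_mult End_graph_one compose_def)
    have 2: "f x \<in> V" "g x \<in> V" if "x \<in> V" for x
      using fc g that by (auto simp: End_graph_carrier_iff)
    have "bij_betw f V V"
      by (rule bij_betw_byWitness[where f' = g]) (use 1 2 in auto)
    moreover have "(x, y) \<in> E \<longleftrightarrow> (f x, f y) \<in> E" if "x \<in> V" "y \<in> V" for x y
    proof
      assume "(f x, f y) \<in> E"
      then have "(g (f x), g (f y)) \<in> E"
        using g 2 that by (simp add: End_graph_carrier_iff)
      then show "(x, y) \<in> E" using 1 that by simp
    qed (use fc that in \<open>simp add: End_graph_carrier_iff\<close>)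
    ultimately show ?thesis
      using fc by (simp add: Aut_graph_def End_graph_carrier_iff PiE_iff)
  qed
  ultimately have "carrier (Aut_graph V E) = Units (End_graph V E)"
    by blast
  then show ?thesis
    by (simp add: Aut_graph_def units_of_def End_graph_def)
qed

lemma Aut_graph_group: "group (Aut_graph V E)"
  unfolding Aut_graph_eq_units using End_graph_monoid by (rule monoid.units_group)

lemma Aut_graph_carrier: "carrier (Aut_graph V E) = Units (End_graph V E)"
  by (simp add: Aut_graph_eq_units units_of_def)

lemma graph_iso_restrict_Aut:
  assumes "graph_iso V E V E \<phi>"
  shows "restrict \<phi> V \<in> carrier (Aut_graph V E)"
  using assms by (simp add: graph_iso_def Aut_graph_def cong: bij_betw_cong)

lemma Aut_graph_iso:
  assumes "f \<in> carrier (Aut_graph V E)"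
  shows "graph_iso V E V E f"
  using assms by (simp add: graph_iso_def Aut_graph_def)

text \<open>\<open>f\<close> passes from \<open>VR\<close> to its copy \<open>verts V\<close>, then
  to the atoms of the membership graph over the marked graph, and back to \<open>VR\<close>, since
  that membership graph is another copy of it. Base edges are marked edges, so \<open>f\<close> is a
  homomorphism. Its image is a copy of the marked graph, all of whose automorphisms extend to
  \<open>VR\<close>.\<close>

lemma marked_embedding:
  assumes G: "is_graph V E" "countable V" and R: "countable_universal_graph VR ER"
    and \<phi>: "graph_iso (verts V) (base_edges V) VR ER \<phi>"
  shows "\<exists>f\<in>carrier (End_graph VR ER). inj_on f VR \<and>
    (\<forall>x\<in>verts V. \<forall>y\<in>verts V. (f (\<phi> x), f (\<phi> y)) \<in> ER \<longleftrightarrow> (x, y) \<in> marked_edges V E S) \<and>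
    (\<forall>\<sigma>. graph_iso (verts V) (marked_edges V E S) (verts V) (marked_edges V E S) \<sigma> \<longrightarrow>
      (\<exists>t\<in>carrier (End_graph VR ER). \<forall>x\<in>verts V. t (f (\<phi> x)) = f (\<phi> (\<sigma> x))))"
proof -
  let ?P = "verts V" and ?M = "marked_edges V E S"
  let ?K = "hf_over ?P" and ?EK = "hf_edges ?P ?M"
  have cR: "countable VR"
    using R by (simp add: countable_universal_graph_def)
  have "countable ?P"
    unfolding verts_def using G(2) by (intro countable_hf_over) simp
  then have cK: "countable ?K"
    by (rule countable_hf_over)
  have ecK: "ec_graph ?K ?EK"
    using marked_edges_graph[OF G(1)] by (rule ec_graph_hf)
  obtain \<psi> where \<psi>: "graph_iso ?K ?EK VR ER \<psi>"
    using ec_graph_unique[OF ecK cK universal_graph_ec[OF R] cR] .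
  let ?i = "inv_into ?P \<phi>" and ?j = "inv_into ?K \<psi>"
  have i: "graph_iso VR ER ?P (base_edges V) ?i" and j: "graph_iso VR ER ?K ?EK ?j"
    using graph_iso_inv[OF \<phi>] graph_iso_inv[OF \<psi>] .
  have iP: "?i x \<in> ?P" if "x \<in> VR" for x
    using i that by (auto simp: graph_iso_def bij_betw_apply)
  have i\<phi>: "?i (\<phi> x) = x" "\<phi> x \<in> VR" if "x \<in> ?P" for x
    using \<phi> that by (auto simp: graph_iso_def bij_betw_inv_into_left bij_betw_apply)
  have j\<psi>: "?j (\<psi> x) = x" "\<psi> x \<in> VR" if "x \<in> ?K" for x
    using \<psi> that by (auto simp: graph_iso_def bij_betw_inv_into_left bij_betw_apply)
  have \<psi>adj: "(\<psi> (Atom x), \<psi> (Atom y)) \<in> ER \<longleftrightarrow> (x, y) \<in> ?M" if "x \<in> ?P" "y \<in> ?P" for x y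
    using \<psi> that by (simp add: graph_iso_def hf_edges_def)
  have \<psi>inj: "\<psi> (Atom x) = \<psi> (Atom y) \<longleftrightarrow> x = y" if "x \<in> ?P" "y \<in> ?P" for x y
    using that by (metis hf_over_simps(1) hf.inject(1) j\<psi>(1))
  define f where "f = (\<lambda>x\<in>VR. \<psi> (Atom (?i x)))"
  have f\<phi>: "f (\<phi> x) = \<psi> (Atom x)" if "x \<in> ?P" for x
    using i\<phi>[OF that] by (simp add: f_def)
  have "f \<in> carrier (End_graph VR ER)"
    unfolding End_graph_carrier_iff
  proof (intro conjI ballI impI)
    show "f \<in> VR \<rightarrow>\<^sub>E VR"
      using j\<psi>(2) iP by (auto simp: f_def)
    fix x y assume xy: "x \<in> VR" "y \<in> VR" "(x, y) \<in> ER"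
    then have "(?i x, ?i y) \<in> ?M"
      using i by (simp add: graph_iso_def marked_edges_def)
    then show "(f x, f y) \<in> ER"
      using \<psi>adj iP xy by (simp add: f_def)
  qed
  moreover have "inj_on f VR"
  proof (rule inj_onI)
    fix x y assume xy: "x \<in> VR" "y \<in> VR" "f x = f y"
    then have "?i x = ?i y"
      using \<psi>inj iP by (simp add: f_def)
    then show "x = y"
      using i xy by (auto simp: graph_iso_def bij_betw_def inj_on_eq_iff)
  qed
  moreover have "(f (\<phi> x), f (\<phi> y)) \<in> ER \<longleftrightarrow> (x, y) \<in> ?M" if "x \<in> ?P" "y \<in> ?P" for x y
    using f\<phi> \<psi>adj that by simp
  moreover have "\<exists>t\<in>carrier (End_graph VR ER). \<forall>x\<in>?P. t (f (\<phi> x)) = f (\<phi> (\<sigma> x))"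
    if \<sigma>: "graph_iso ?P ?M ?P ?M \<sigma>" for \<sigma>
  proof
    \<comment> \<open>The extension acts on the whole membership graph by
      \<open>map_hf \<sigma>\<close>, which is \<open>\<sigma>\<close> on the atoms.\<close>
    let ?t = "\<lambda>y\<in>VR. \<psi> (map_hf \<sigma> (?j y))"
    have "?t \<in> carrier (Aut_graph VR ER)"
      using graph_iso_trans[OF j graph_iso_trans[OF graph_iso_map_hf[OF \<sigma>] \<psi>]]
      by (rule graph_iso_restrict_Aut)
    then show "?t \<in> carrier (End_graph VR ER)"
      by (simp add: Aut_graph_carrier Units_def)
    show "\<forall>x\<in>?P. ?t (f (\<phi> x)) = f (\<phi> (\<sigma> x))"
    proof
      fix x assume x: "x \<in> ?P"
      then have "\<sigma> x \<in> ?P"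
        using \<sigma> by (auto simp: graph_iso_def bij_betw_apply)
      then show "?t (f (\<phi> x)) = f (\<phi> (\<sigma> x))"
        using x f\<phi> j\<psi> by simp
    qed
  qed
  ultimately show ?thesis
    by (intro bexI[of _ f]) auto
qed

text \<open>A function is coded by its graph, a subset of the countable set
  \<open>W \<times> W\<close>.\<close>

lemma functions_lepoll_nat_sets:
  assumes "countable W"
  shows "(W \<rightarrow>\<^sub>E W) \<lesssim> (UNIV :: nat set set)"
proof -
  let ?c = "to_nat_on (W \<times> W)"
  let ?g = "\<lambda>f. ?c ` ((\<lambda>x. (x, f x)) ` W)"
  have inj: "inj_on ?c (W \<times> W)"
    using assms by (intro inj_on_to_nat_on) auto
  have "inj_on ?g (W \<rightarrow>\<^sub>E W)"
  proof (rule inj_onI)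
    fix f h assume f: "f \<in> W \<rightarrow>\<^sub>E W" and h: "h \<in> W \<rightarrow>\<^sub>E W" and eq: "?g f = ?g h"
    have "(\<lambda>x. (x, f x)) ` W \<subseteq> W \<times> W" "(\<lambda>x. (x, h x)) ` W \<subseteq> W \<times> W"
      using f h by auto
    then have "(\<lambda>x. (x, f x)) ` W = (\<lambda>x. (x, h x)) ` W"
      using inj_on_image_eq_iff[OF inj, THEN iffD1, OF _ _ eq] by blast
    then show "f = h"
      using f h by (intro PiE_ext) auto
  qed
  then show ?thesis
    unfolding lepoll_def by blast
qed

theorem theorem3p13:
  fixes V :: "'a set" and E :: "('a \<times> 'a) set"
    and VR :: "'b set" and ER :: "('b \<times> 'b) set"
  assumes "is_graph V E" and "countable V"
    and "countable_universal_graph VR ER"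
  shows "{D \<in> carrier (End_graph VR ER) // green_D (End_graph VR ER).
            (\<forall>f\<in>D. \<not> regular_elem (End_graph VR ER) f) \<and>
            (\<forall>H \<in> carrier (End_graph VR ER) // green_H (End_graph VR ER).
               H \<subseteq> D \<longrightarrow> Schutzenberger_group (End_graph VR ER) H \<cong> Aut_graph V E)}
         \<approx> (UNIV :: nat set set)" (is "?\<D> \<approx> _")
proof -
  define M where "M = End_graph VR ER"
  interpret monoid M
    unfolding M_def by (rule End_graph_monoid)
  let ?P = "verts V" and ?A = "Aut_graph V E"
  have symE: "sym E"
    using assms(1) by (simp add: is_graph_def)
  have cR: "countable VR"
    using assms(3) by (simp add: countable_universal_graph_def)
  have ecP: "ec_graph ?P (base_edges V)"
    unfolding verts_def base_edges_def by (rule ec_graph_hf) (simp add: is_graph_def irrefl_def sym_def)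
  have cP: "countable ?P"
    unfolding verts_def using assms(2) by (intro countable_hf_over) simp
  obtain \<phi> where \<phi>: "graph_iso ?P (base_edges V) VR ER \<phi>"
    using ec_graph_unique[OF ecP cP universal_graph_ec[OF assms(3)] cR] .
  let ?i = "inv_into ?P \<phi>"
  have i: "graph_iso VR ER ?P (base_edges V) ?i"
    using \<phi> by (rule graph_iso_inv)
  have iP: "?i x \<in> ?P" "\<phi> (?i x) = x" if "x \<in> VR" for x
    using \<phi> that by (auto simp: graph_iso_def bij_betw_def inv_into_into f_inv_into_f)
  have i\<phi>: "?i (\<phi> x) = x" "\<phi> x \<in> VR" if "x \<in> ?P" for x
    using \<phi> that by (auto simp: graph_iso_def bij_betw_inv_into_left bij_betw_apply)
  have \<phi>eq: "\<phi> x = \<phi> y \<longleftrightarrow> x = y" if "x \<in> ?P" "y \<in> ?P" for x y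
    using i\<phi>(1) that by metis
  have \<phi>adj: "(\<phi> x, \<phi> y) \<in> ER \<longleftrightarrow> (x, y) \<in> base_edges V" if "x \<in> ?P" "y \<in> ?P" for x y
    using \<phi> that by (simp add: graph_iso_def)
  \<comment> \<open>One injective endomorphism for each set \<open>S\<close>, whose image is a copy
    of the graph marked by \<open>S\<close>.\<close>
  obtain F where Fc: "\<And>S. F S \<in> carrier M" and Finj: "\<And>S. inj_on (F S) VR"
    and Fadj: "\<And>S x y. x \<in> ?P \<Longrightarrow> y \<in> ?P \<Longrightarrow>
      (F S (\<phi> x), F S (\<phi> y)) \<in> ER \<longleftrightarrow> (x, y) \<in> marked_edges V E S"
    and Fext: "\<And>S \<sigma>. graph_iso ?P (marked_edges V E S) ?P (marked_edges V E S) \<sigma> \<Longrightarrow>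
      \<exists>t\<in>carrier M. \<forall>x\<in>?P. t (F S (\<phi> x)) = F S (\<phi> (\<sigma> x))"
    using marked_embedding[OF assms \<phi>] unfolding M_def by metis
  have MV: "f x \<in> VR" if "f \<in> carrier M" "x \<in> VR" for f x
    using that by (auto simp: M_def End_graph_carrier_iff)
  have Madj: "(f x, f y) \<in> ER" if "f \<in> carrier M" "x \<in> VR" "y \<in> VR" "(x, y) \<in> ER" for f x y
    using that by (simp add: M_def End_graph_carrier_iff)
  have Mapp: "(f \<otimes>\<^bsub>M\<^esub> g) x = g (f x)" if "x \<in> VR" for f g x
    using that unfolding M_def by (rule End_graph_mult_apply)
  have Meq: "f = g" if "f \<in> carrier M" "g \<in> carrier M" "\<And>x. x \<in> ?P \<Longrightarrow> f (\<phi> x) = g (\<phi> x)" for f g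
    using that iP unfolding M_def by (metis End_graph_eqI)
  \<comment> \<open>The factor to be cancelled acts last, so its injectivity is what cancellation
    asks for.\<close>
  have rc: "right_cancellable (F S)" for S
    unfolding right_cancellable_def
  proof (intro conjI ballI impI Fc)
    fix f g assume f: "f \<in> carrier M" and g: "g \<in> carrier M" and eq: "f \<otimes>\<^bsub>M\<^esub> F S = g \<otimes>\<^bsub>M\<^esub> F S"
    have "f x = g x" if x: "x \<in> VR" for x
      using fun_cong[OF eq, of x] Mapp[OF x] Finj[of S] MV[OF f x] MV[OF g x]
      by (simp add: inj_on_eq_iff)
    then show "f = g"
      using f g unfolding M_def by (rule End_graph_eqI[rotated 2])
  qed
  \<comment> \<open>\<open>b\<close> read on \<open>verts V\<close>. Since \<open>b\<close> acts
    before \<open>F S\<close>, the relation of \<open>b (F S)\<close> to \<open>F S'\<close> gives a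
    map from the marking by \<open>S'\<close> to the marking by \<open>S\<close>.\<close>
  define \<sigma> where "\<sigma> b x = ?i (b (\<phi> x))" for b :: "'b \<Rightarrow> 'b" and x
  have \<sigma>iso: "graph_iso ?P (base_edges V) ?P (base_edges V) (\<sigma> b) \<and>
      graph_iso ?P (marked_edges V E S') ?P (marked_edges V E S) (\<sigma> b)"
    if b: "b \<in> Units M" and bR: "(b \<otimes>\<^bsub>M\<^esub> F S, F S') \<in> green_R M" for b S S'
  proof
    have "graph_iso VR ER VR ER b"
      using b unfolding M_def by (intro Aut_graph_iso) (simp add: Aut_graph_carrier)
    from graph_iso_trans[OF \<phi> graph_iso_trans[OF this i]]
    show base: "graph_iso ?P (base_edges V) ?P (base_edges V) (\<sigma> b)"
      unfolding \<sigma>_def .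
    have bc: "b \<in> carrier M" using b by (rule Units_closed)
    obtain c d where c: "c \<in> carrier M" "b \<otimes>\<^bsub>M\<^esub> F S = F S' \<otimes>\<^bsub>M\<^esub> c"
      and d: "d \<in> carrier M" "F S' = b \<otimes>\<^bsub>M\<^esub> F S \<otimes>\<^bsub>M\<^esub> d"
      using bR unfolding green_R_iff by blast
    have 1: "c (F S' (\<phi> x)) = F S (\<phi> (\<sigma> b x))" "d (F S (\<phi> (\<sigma> b x))) = F S' (\<phi> x)"
      "\<sigma> b x \<in> ?P" "F S' (\<phi> x) \<in> VR" "F S (\<phi> (\<sigma> b x)) \<in> VR" if x: "x \<in> ?P" for x
    proof -
      have v: "\<phi> x \<in> VR" "b (\<phi> x) \<in> VR" using i\<phi>(2)[OF x] MV[OF bc] by auto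
      have s: "\<phi> (\<sigma> b x) = b (\<phi> x)"
        unfolding \<sigma>_def using iP(2)[OF v(2)] .
      show "c (F S' (\<phi> x)) = F S (\<phi> (\<sigma> b x))"
        using fun_cong[OF c(2), of "\<phi> x"] Mapp[OF v(1)] s by simp
      show "d (F S (\<phi> (\<sigma> b x))) = F S' (\<phi> x)"
        using fun_cong[OF d(2), of "\<phi> x"] Mapp[OF v(1)] s by simp
      show "\<sigma> b x \<in> ?P"
        unfolding \<sigma>_def using iP(1)[OF v(2)] .
      show "F S' (\<phi> x) \<in> VR" "F S (\<phi> (\<sigma> b x)) \<in> VR"
        using MV Fc v s by auto
    qed
    \<comment> \<open>The endomorphisms \<open>c\<close> and \<open>d\<close> exchange the images
      under \<open>F S'\<close> and \<open>F S\<close> of corresponding vertices, so adjacency is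
      both preserved and reflected.\<close>
    have "(\<sigma> b x, \<sigma> b y) \<in> marked_edges V E S \<longleftrightarrow> (x, y) \<in> marked_edges V E S'"
      if x: "x \<in> ?P" and y: "y \<in> ?P" for x y
    proof -
      note x1 = 1[OF x] and y1 = 1[OF y]
      have "(F S' (\<phi> x), F S' (\<phi> y)) \<in> ER \<longleftrightarrow> (F S (\<phi> (\<sigma> b x)), F S (\<phi> (\<sigma> b y))) \<in> ER"
        using Madj[OF c(1) x1(4) y1(4)] Madj[OF d(1) x1(5) y1(5)]
        unfolding x1(1,2) y1(1,2) by blast
      then show ?thesis
        using Fadj x y x1(3) y1(3) by simp
    qed
    then show "graph_iso ?P (marked_edges V E S') ?P (marked_edges V E S) (\<sigma> b)"
      using base by (simp add: graph_iso_def)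
  qed
  \<comment> \<open>By cancellation, regularity would give an endomorphism \<open>g\<close> undoing
    \<open>F S\<close>, and \<open>g\<close> would carry every marked edge back to a base
    edge.\<close>
  have nonreg: "\<not> regular_elem M (F S)" for S
  proof
    assume "regular_elem M (F S)"
    then obtain g where g: "g \<in> carrier M" "F S \<otimes>\<^bsub>M\<^esub> g \<otimes>\<^bsub>M\<^esub> F S = F S"
      by (auto simp: regular_elem_def)
    then have one: "F S \<otimes>\<^bsub>M\<^esub> g = \<one>\<^bsub>M\<^esub>"
      using Fc by (intro right_cancellable_unit[OF rc]) auto
    have gF: "g (F S (\<phi> x)) = \<phi> x" if "x \<in> ?P" for x
      using fun_cong[OF one, of "\<phi> x"] Mapp i\<phi>(2)[OF that] by (simp add: M_def End_graph_one)
    \<comment> \<open>The empty set has rank 1, so the marking joins it to \<open>clock 0\<close>,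
      although neither is a member of the other.\<close>
    let ?x = "tower 0 :: ('a + nat) hf" and ?y = "clock 0 :: ('a + nat) hf"
    have xy: "?x \<in> ?P" "?y \<in> ?P" "?x \<notin> range clock" by auto
    have "(?x, ?y) \<in> marked_edges V E S"
      using marked_edges_clock[OF xy(1,3), of 0 E S] by (simp del: tower.simps)
    then have "(F S (\<phi> ?x), F S (\<phi> ?y)) \<in> ER"
      using Fadj xy(1,2) by blast
    then have "(g (F S (\<phi> ?x)), g (F S (\<phi> ?y))) \<in> ER"
      using Madj[OF g(1)] MV[OF Fc] i\<phi>(2) xy(1,2) by blast
    then have "(?x, ?y) \<in> base_edges V"
      using \<phi>adj gF xy(1,2) by metis
    then show False
      by (simp add: base_edges_iff)
  qed
  define lft where "lft \<tau> = map_hf (map_sum \<tau> (id :: nat \<Rightarrow> nat))" for \<tau> :: "'a \<Rightarrow> 'a"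
  \<comment> \<open>The lift of \<open>\<tau>\<close>, transported along \<open>\<phi>\<close> to an
    automorphism of \<open>VR\<close>.\<close>
  define \<theta> where "\<theta> \<tau> = (\<lambda>x\<in>VR. \<phi> (lft \<tau> (?i x)))" for \<tau> :: "'a \<Rightarrow> 'a"
  have lft: "graph_iso ?P (base_edges V) ?P (base_edges V) (lft \<tau>)"
      "graph_iso ?P (marked_edges V E S) ?P (marked_edges V E S) (lft \<tau>)" if "\<tau> \<in> carrier ?A" for \<tau> S
    unfolding lft_def using lift_automorphism[OF symE that] by auto
  have lftP: "lft \<tau> x \<in> ?P" if "\<tau> \<in> carrier ?A" "x \<in> ?P" for \<tau> x
    using lft(1)[OF that(1)] that(2) by (auto simp: graph_iso_def bij_betw_apply)
  have \<theta>\<phi>: "\<theta> \<tau> (\<phi> x) = \<phi> (lft \<tau> x)" if "x \<in> ?P" for \<tau> x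
    using i\<phi>[OF that] by (simp add: \<theta>_def)
  have \<theta>U: "\<theta> \<tau> \<in> Units M" if "\<tau> \<in> carrier ?A" for \<tau>
    unfolding \<theta>_def M_def Aut_graph_carrier[symmetric]
    using graph_iso_trans[OF i graph_iso_trans[OF lft(1)[OF that] \<phi>]] by (rule graph_iso_restrict_Aut)
  have \<theta>c: "\<theta> \<tau> \<in> carrier M" if "\<tau> \<in> carrier ?A" for \<tau>
    using \<theta>U[OF that] by (rule Units_closed)
  \<comment> \<open>The lift and its inverse both preserve the marking; their extensions
    \<open>t\<close> and \<open>s\<close> are the right multipliers in the two directions.\<close>
  have \<theta>R: "(\<theta> \<tau> \<otimes>\<^bsub>M\<^esub> F S, F S) \<in> green_R M" if \<tau>: "\<tau> \<in> carrier ?A" for \<tau> S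
  proof -
    obtain t where t: "t \<in> carrier M" "\<And>x. x \<in> ?P \<Longrightarrow> t (F S (\<phi> x)) = F S (\<phi> (lft \<tau> x))"
      using Fext[OF lft(2)[OF \<tau>]] by blast
    obtain s where s: "s \<in> carrier M"
      "\<And>x. x \<in> ?P \<Longrightarrow> s (F S (\<phi> x)) = F S (\<phi> (inv_into ?P (lft \<tau>) x))"
      using Fext[OF graph_iso_inv[OF lft(2)[OF \<tau>]]] by blast
    have "inv_into ?P (lft \<tau>) (lft \<tau> x) = x" if "x \<in> ?P" for x
      using lft(1)[OF \<tau>] that by (auto simp: graph_iso_def intro: bij_betw_inv_into_left)
    then have "F S = \<theta> \<tau> \<otimes>\<^bsub>M\<^esub> F S \<otimes>\<^bsub>M\<^esub> s"
      using \<theta>c[OF \<tau>] Fc s(1) by (intro Meq) (simp_all add: Mapp i\<phi>(2) \<theta>\<phi> s(2) lftP[OF \<tau>])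
    moreover have "\<theta> \<tau> \<otimes>\<^bsub>M\<^esub> F S = F S \<otimes>\<^bsub>M\<^esub> t"
      using \<theta>c[OF \<tau>] Fc t(1) by (intro Meq) (simp_all add: Mapp i\<phi>(2) \<theta>\<phi> t(2))
    ultimately show ?thesis
      unfolding green_R_iff using \<theta>c[OF \<tau>] Fc t(1) s(1) m_closed by blast
  qed
  have A_iso: "?A \<cong> Schutzenberger_group M (green_H M `` {F S})" for S
  proof (rule Schutzenberger_right_cancellable[OF rc])
    show closed: "x \<otimes>\<^bsub>?A\<^esub> y \<in> carrier ?A" if "x \<in> carrier ?A" "y \<in> carrier ?A" for x y
      using Aut_graph_group that by (metis group.is_monoid monoid.m_closed)
    show "\<theta> \<in> hom ?A M"
    proof (rule homI)
      fix \<tau> \<rho> assume \<tau>: "\<tau> \<in> carrier ?A" and \<rho>: "\<rho> \<in> carrier ?A"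
      have "lft (\<tau> \<otimes>\<^bsub>?A\<^esub> \<rho>) x = lft \<rho> (lft \<tau> x)" if "x \<in> ?P" for x
      proof -
        have "lft (\<tau> \<otimes>\<^bsub>?A\<^esub> \<rho>) x = map_hf (map_sum \<rho> id \<circ> map_sum \<tau> id) x"
          unfolding lft_def
          using that by (intro map_hf_cong_over[of x "V <+> UNIV"])
            (auto simp: verts_def Aut_graph_def compose_def)
        then show ?thesis
          by (simp only: lft_def hf.map_comp)
      qed
      then show "\<theta> (\<tau> \<otimes>\<^bsub>?A\<^esub> \<rho>) = \<theta> \<tau> \<otimes>\<^bsub>M\<^esub> \<theta> \<rho>"
        using \<theta>c closed \<tau> \<rho> by (intro Meq) (simp_all add: Mapp i\<phi>(2) \<theta>\<phi> lftP[OF \<tau>])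
    qed (rule \<theta>c)
    show "inj_on \<theta> (carrier ?A)"
    proof (rule inj_onI)
      fix \<tau> \<rho> assume \<tau>: "\<tau> \<in> carrier ?A" and \<rho>: "\<rho> \<in> carrier ?A" and eq: "\<theta> \<tau> = \<theta> \<rho>"
      have "\<tau> v = \<rho> v" if v: "v \<in> V" for v
      proof -
        have p: "point v \<in> ?P" using v by simp
        have "\<phi> (lft \<tau> (point v)) = \<phi> (lft \<rho> (point v))"
          using eq \<theta>\<phi>[OF p] by metis
        then have "lft \<tau> (point v) = lft \<rho> (point v)"
          using \<phi>eq lftP \<tau> \<rho> p by simp
        then show ?thesis by (simp add: lft_def)
      qed
      then show "\<tau> = \<rho>"
        using \<tau> \<rho> unfolding Aut_graph_def by (auto intro: extensionalityI)
    qed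
    show "\<theta> ` carrier ?A = {u \<in> Units M. (u \<otimes>\<^bsub>M\<^esub> F S, F S) \<in> green_R M}"
    proof
      show "\<theta> ` carrier ?A \<subseteq> {u \<in> Units M. (u \<otimes>\<^bsub>M\<^esub> F S, F S) \<in> green_R M}"
        using \<theta>U \<theta>R by blast
      show "{u \<in> Units M. (u \<otimes>\<^bsub>M\<^esub> F S, F S) \<in> green_R M} \<subseteq> \<theta> ` carrier ?A"
      proof
        fix u assume "u \<in> {u \<in> Units M. (u \<otimes>\<^bsub>M\<^esub> F S, F S) \<in> green_R M}"
        then have u: "u \<in> Units M" and uR: "(u \<otimes>\<^bsub>M\<^esub> F S, F S) \<in> green_R M" by auto
        \<comment> \<open>Rigidity: a unit that stabilises the R-class of \<open>F S\<close> induces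
          an automorphism of both structures, hence a lift.\<close>
        obtain \<tau> where \<tau>: "\<tau> \<in> carrier ?A" "\<And>x. x \<in> ?P \<Longrightarrow> \<sigma> u x = lft \<tau> x"
          using marked_iso_rigid(2)[OF symE] \<sigma>iso[OF u uR] unfolding lft_def by blast
        have uc: "u \<in> carrier M" using u by (rule Units_closed)
        have "u = \<theta> \<tau>"
        proof (rule Meq[OF uc \<theta>c[OF \<tau>(1)]])
          fix x assume x: "x \<in> ?P"
          have "u (\<phi> x) = \<phi> (\<sigma> u x)"
            unfolding \<sigma>_def using iP(2)[OF MV[OF uc i\<phi>(2)[OF x]]] by simp
          then show "u (\<phi> x) = \<theta> \<tau> (\<phi> x)"
            using \<tau>(2)[OF x] \<theta>\<phi>[OF x] by simp
        qed
        then show "u \<in> \<theta> ` carrier ?A" using \<tau>(1) by blast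
      qed
    qed
  qed
  let ?D = "\<lambda>S. green_D M `` {F S}"
  have D_in: "?D S \<in> ?\<D>" for S
    unfolding M_def[symmetric]
  proof (intro CollectI conjI ballI impI)
    show "?D S \<in> carrier M // green_D M"
      using Fc by (rule quotientI)
    show "\<not> regular_elem M h" if h: "h \<in> ?D S" for h
    proof -
      obtain a b c d where "D_linked (F S) h a b c d"
        using h green_D_linked by blast
      then show ?thesis using nonreg regular_elem_D_linked by blast
    qed
    fix H assume H: "H \<in> carrier M // green_H M" and sub: "H \<subseteq> ?D S"
    obtain h where h: "h \<in> carrier M" "H = green_H M `` {h}"
      using H by (rule quotientE)
    then have "h \<in> ?D S"
      using green_H_refl sub by blast
    \<comment> \<open>Every H-class inside the D-class is linked to that of \<open>F S\<close>, so
      Green's lemma carries the group over.\<close>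
    then obtain a b c d where lk: "D_linked (F S) h a b c d"
      using green_D_linked by blast
    have "?A \<cong> Schutzenberger_group M H"
      unfolding h(2) using A_iso Schutzenberger_D_linked[OF lk] by (rule iso_trans)
    then show "Schutzenberger_group M H \<cong> ?A"
      by (rule group.iso_sym[OF Aut_graph_group])
  qed
  have "inj ?D"
  proof (rule injI)
    fix S S' assume "?D S = ?D S'"
    then have "(F S, F S') \<in> green_D M"
      using green_D_refl[OF Fc] by blast
    then obtain b where b: "b \<in> Units M" "(b \<otimes>\<^bsub>M\<^esub> F S, F S') \<in> green_R M"
      using rc by (metis right_cancellable_green_D)
    \<comment> \<open>The unit \<open>b\<close> induces an isomorphism between the two markings,
      from which the coded set is read off.\<close>
    show "S = S'"
      using marked_iso_rigid(1)[OF symE] \<sigma>iso[OF b] by blast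
  qed
  then have lower: "(UNIV :: nat set set) \<lesssim> ?\<D>"
    unfolding lepoll_def using D_in by blast
  \<comment> \<open>Upper bound: the classes are indexed by endomorphisms, which are functions on a
    countable set.\<close>
  have "?\<D> \<subseteq> (\<lambda>f. green_D M `` {f}) ` carrier M"
    unfolding M_def[symmetric] quotient_def by blast
  then have "?\<D> \<lesssim> (\<lambda>f. green_D M `` {f}) ` carrier M"
    by (rule subset_imp_lepoll)
  also have "\<dots> \<lesssim> carrier M"
    by (rule image_lepoll)
  also have "\<dots> \<lesssim> (VR \<rightarrow>\<^sub>E VR)"
    by (rule subset_imp_lepoll) (auto simp: M_def End_graph_def)
  also have "\<dots> \<lesssim> (UNIV :: nat set set)"
    using cR by (rule functions_lepoll_nat_sets)
  finally show ?thesis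
    using lower by (rule lepoll_antisym)
qed

end
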